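(* Let $\mathbb{F}=\mathbb{R}$ or $\mathbb{F}=\mathbb{C}$, let $m,n,d$ be positive integers, let $M(\lambda)\in\mathbb{F}[\lambda]^{m\times(m+n)}_d$ be a polynomial matrix with full-Sylvester-rank, and let $k'=\left\lceil\frac{md}{n}\right\rceil$ and $t=nk'-md$ (so $0\le t<n$). Then: (a) If $k'>1$ and $t>0$, then every $\widetilde M(\lambda)\in\mathbb{F}[\lambda]^{m\times(m+n)}_d$ such that $$\|S_1(M)-S_1(\widetilde M)\|_2<\min\left\{\frac{\sigma_{(k'-1)(m+n)}(S_{k'-1}(M))}{\sqrt{k'-1}},\ \frac{\sigma_{(k'+d)m}(S_{k'}(M))}{\sqrt{k'}}\right\}$$ has full-Sylvester-rank. (b) If $k'=1$ or $t=0$, then every $\widetilde M(\lambda)\in\mathbb{F}[\lambda]^{m\times(m+n)}_d$ such that $$\|S_1(M)-S_1(\widetilde M)\|_2<\frac{\sigma_{(k'+d)m}(S_{k'}(M))}{\sqrt{k'}}$$ has full-Sylvester-rank.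
   Context: $\mathbb{F}[\lambda]^{m\times(m+n)}_d$ is the $\mathbb{F}$-vector space of $m\times(m+n)$ polynomial matrices of degree at most $d$. Sylvester matrices: for $P(\lambda)=P_0+P_1\lambda+\cdots+P_d\lambda^d\in\mathbb{F}[\lambda]^{m\times(m+n)}_d$ and $k\ge1$, $S_k(P)\in\mathbb{F}^{(k+d)m\times k(m+n)}$ is the block matrix with $k+d$ block rows and $k$ block columns whose $(i,j)$ block is $P_{i-j}$ if $0\le i-j\le d$ and $0$ otherwise. $P(\lambda)$ has full-Sylvester-rank if $\operatorname{rank}S_k(P)=\min\{(k+d)m,\;k(m+n)\}$ for all $k=1,2,\dots$. $\sigma_1(A)\ge\sigma_2(A)\ge\cdots\ge\sigma_{\min\{p,q\}}(A)$ are the singular values of $A\in\mathbb{F}^{p\times q}$ and $\|A\|_2=\sigma_1(A)$. *)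

theory Defs
  imports
    "HOL-Analysis.Analysis"
    "Jordan_Normal_Form.Schur_Decomposition"
    "Jordan_Normal_Form.DL_Rank"
begin

text \<open>Polynomial matrices are matrices over the polynomial ring. The grade \<open>d\<close> is only an upper
  bound for the degree of the entries, so it is carried as an explicit parameter.\<close>

definition polymats :: "nat \<Rightarrow> nat \<Rightarrow> nat \<Rightarrow> 'a::field poly mat set" where
  "polymats p q d = {P \<in> carrier_mat p q. \<forall>i<p. \<forall>j<q. degree (P $$ (i, j)) \<le> d}"

definition coeff_mat :: "'a::field poly mat \<Rightarrow> nat \<Rightarrow> 'a mat" where
  "coeff_mat P i = map_mat (\<lambda>f. coeff f i) P"

text \<open>Rows and columns are numbered from 0: row \<open>r\<close> is row \<open>r mod p\<close> of block row \<open>r div p\<close>, where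
  \<open>p\<close> is the number of rows of a block, and similarly for columns.\<close>

definition sylvester :: "nat \<Rightarrow> nat \<Rightarrow> 'a::field poly mat \<Rightarrow> 'a mat" where
  "sylvester d k P =
     mat ((k + d) * dim_row P) (k * dim_col P)
       (\<lambda>(r, c).
          let i = r div dim_row P; j = c div dim_col P in
          if j \<le> i \<and> i - j \<le> d
          then coeff_mat P (i - j) $$ (r mod dim_row P, c mod dim_col P)
          else 0)"

definition mat_rank :: "'a::field mat \<Rightarrow> nat" where
  "mat_rank A = vec_space.rank (dim_row A) A"

definition full_sylvester_rank :: "nat \<Rightarrow> 'a::field poly mat \<Rightarrow> bool" where
  "full_sylvester_rank d P \<longleftrightarrow>
     (\<forall>k\<ge>1. mat_rank (sylvester d k P) = min ((k + d) * dim_row P) (k * dim_col P))"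

text \<open>The singular values in decreasing order: the square roots of the eigenvalues of \<open>A\<^sup>* A\<close>, counted
  with multiplicity, without the \<open>q - p\<close> superfluous zeros if \<open>A\<close> is \<open>p \<times> q\<close> with \<open>p < q\<close>.
  For real and complex \<open>A\<close> (for which \<^term>\<open>conjugate\<close> is the identity and complex conjugation) the
  eigenvalues of \<open>A\<^sup>* A\<close> are nonnegative reals, so \<^term>\<open>norm\<close> only casts them to type \<^typ>\<open>real\<close>.\<close>

definition singular_values :: "'a::{conjugatable_field, real_normed_field} mat \<Rightarrow> real list" where
  "singular_values A =
     take (min (dim_row A) (dim_col A))
       (rev (sorted_list_of_multiset
         (image_mset (\<lambda>e. sqrt (norm e)) (proots (char_poly (mat_adjoint A * A))))))"

text \<open>Singular values are numbered from 1, for \<open>1 \<le> i \<le> min p q\<close>.\<close>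

definition sing_val :: "nat \<Rightarrow> 'a::{conjugatable_field, real_normed_field} mat \<Rightarrow> real" where
  "sing_val i A = singular_values A ! (i - 1)"

definition norm2 :: "'a::{conjugatable_field, real_normed_field} mat \<Rightarrow> real" where
  "norm2 A = sing_val 1 A"

end

theory Submission
  imports Defs
begin

text \<open>
  A matrix keeps full rank under every perturbation whose spectral norm is below its smallest singular
  value. Moreover \<open>\<parallel>S\<^sub>k(E)\<parallel> \<le> \<surd>k \<parallel>S\<^sub>1(E)\<parallel>\<close>: each block column of \<open>S\<^sub>k(E)\<close> is a shifted copy of
  \<open>S\<^sub>1(E)\<close>, so the adjoint of \<open>S\<^sub>k(E)\<close> applies the adjoint of \<open>S\<^sub>1(E)\<close> to \<open>k\<close> overlapping windows
  of a vector, each of norm at most that of the whole vector. So the hypotheses give full row rank of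
  \<open>S\<^bsub>k'\<^esub>\<close> and full column rank of \<open>S\<^bsub>k'-1\<^esub>\<close> (of \<open>S\<^bsub>k'\<^esub>\<close> itself, which is then square,
  if \<open>t = 0\<close>) for the perturbed matrix. Full row rank passes from \<open>k\<close> to \<open>k + 1\<close>, since a left
  null vector of \<open>S\<^bsub>k+1\<^esub>\<close> without its last or without its first block is one of \<open>S\<^sub>k\<close>, and full
  column rank passes from \<open>k\<close> to all smaller indices, since a null vector can be padded by zeros.
\<close>

section \<open>Adjoints and the spectral theorem\<close>

lemma mat_adjoint_carrier [simp]: "A \<in> carrier_mat p q \<Longrightarrow> mat_adjoint A \<in> carrier_mat q p"
  unfolding mat_adjoint_def by (auto simp: mat_of_rows_def)

lemma dim_mat_adjoint [simp]:
  "dim_row (mat_adjoint A) = dim_col A" "dim_col (mat_adjoint A) = dim_row A"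
  unfolding mat_adjoint_def by (auto simp: mat_of_rows_def)

lemma mat_adjoint_index [simp]:
  "i < dim_col A \<Longrightarrow> j < dim_row A \<Longrightarrow> mat_adjoint A $$ (i, j) = conjugate (A $$ (j, i))"
  unfolding mat_adjoint_def by (auto simp: mat_of_rows_def)

lemma mat_adjoint_adjoint [simp]: "mat_adjoint (mat_adjoint A) = A"
  by (rule eq_matI) auto

lemma mat_adjoint_mult:
  assumes "A \<in> carrier_mat p q" "B \<in> carrier_mat q r"
  shows "mat_adjoint (A * B) = mat_adjoint B * mat_adjoint A"
  using assms
  by (intro eq_matI)
    (auto simp: scalar_prod_def sum_conjugate conjugate_dist_mul mult.commute intro!: sum.cong)

lemma mult_mat_vec_adjoint_scalar_prod:
  assumes "A \<in> carrier_mat p q" "x \<in> carrier_vec q" "y \<in> carrier_vec p"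
  shows "(A *\<^sub>v x) \<bullet>c y = x \<bullet>c (mat_adjoint A *\<^sub>v y)"
proof -
  have "(A *\<^sub>v x) \<bullet>c y = (\<Sum>i<p. \<Sum>j<q. A $$ (i, j) * x $ j * conjugate (y $ i))"
    using assms by (auto simp: scalar_prod_def sum_distrib_right lessThan_atLeast0)
  also have "\<dots> = (\<Sum>j<q. \<Sum>i<p. A $$ (i, j) * x $ j * conjugate (y $ i))"
    by (rule sum.swap)
  also have "\<dots> = x \<bullet>c (mat_adjoint A *\<^sub>v y)"
    using assms
    by (auto simp: scalar_prod_def sum_distrib_left lessThan_atLeast0 sum_conjugate
        conjugate_dist_mul mult_ac intro!: sum.cong)
  finally show ?thesis .
qed

section \<open>Splitting of characteristic polynomials of Hermitian matrices\<close>

text \<open>The fundamental theorem of algebra supplies a complex root, which is real by assumption.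
  Its linear factor can be divided off over the reals, and the quotient is again monic and
  real-rooted.\<close>

lemma real_rooted_poly_splits:
  fixes p :: "real poly"
  assumes "monic p"
    and "\<And>z. poly (map_poly complex_of_real p) z = 0 \<Longrightarrow> z \<in> \<real>"
  shows "\<exists>es. p = (\<Prod>e\<leftarrow>es. [:- e, 1:])"
  using assms
proof (induction "degree p" arbitrary: p)
  case 0
  then have "p = 1" by (metis monic_degree_0)
  then show ?case by (intro exI[of _ "[]"]) simp
next
  case (Suc k)
  interpret hom: map_poly_comm_ring_hom complex_of_real ..
  have "\<not> constant (poly (map_poly complex_of_real p))"
    using Suc.hyps(2) by (simp add: constant_degree)
  then obtain z where z: "poly (map_poly complex_of_real p) z = 0"
    using fundamental_theorem_of_algebra by blast
  then obtain r where r: "z = of_real r" using Suc.prems(2) Reals_cases by blast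
  then have "poly p r = 0" using z by (simp add: of_real_hom.poly_map_poly)
  then obtain u where u: "p = [:- r, 1:] * u" by (metis dvd_def poly_eq_0_iff_dvd)
  have "u \<noteq> 0" using u Suc.hyps(2) by auto
  then have deg: "k = degree u" using Suc.hyps(2) unfolding u by (subst (asm) degree_mult_eq) auto
  have mon: "monic u" using Suc.prems(1) unfolding u by (simp add: lead_coeff_mult del: mult_pCons_left)
  have "z \<in> \<real>" if "poly (map_poly complex_of_real u) z = 0" for z
    using that Suc.prems(2)[of z] unfolding u by (simp add: hom.hom_mult del: mult_pCons_left)
  then obtain es where "u = (\<Prod>e\<leftarrow>es. [:- e, 1:])" using Suc.hyps(1)[OF deg mon] by blast
  then show ?case unfolding u by (intro exI[of _ "r # es"]) simp
qed

text \<open>For an eigenvector \<open>v\<close>, moving \<open>A\<close> across the inner product of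
  \<open>A *\<^sub>v v\<close> with \<open>v\<close> replaces \<open>e\<close> by
  \<open>cnj e\<close>, while \<open>v \<bullet>c v\<close> is nonzero.\<close>

lemma hermitian_eigenvalue_real:
  fixes A :: "complex mat"
  assumes A: "A \<in> carrier_mat n n" "mat_adjoint A = A" and e: "eigenvalue A e"
  shows "e \<in> \<real>"
proof -
  obtain v where v: "v \<in> carrier_vec n" "v \<noteq> 0\<^sub>v n" "A *\<^sub>v v = e \<cdot>\<^sub>v v"
    using e A unfolding eigenvalue_def eigenvector_def by auto
  have "e * (v \<bullet>c v) = (A *\<^sub>v v) \<bullet>c v" using v by simp
  also have "\<dots> = v \<bullet>c (A *\<^sub>v v)"
    using mult_mat_vec_adjoint_scalar_prod[OF A(1) v(1) v(1)] A(2) by simp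
  also have "\<dots> = cnj e * (v \<bullet>c v)" using v by (simp add: conjugate_smult_vec)
  finally have "cnj e = e" using v by simp
  then show ?thesis by (simp add: Reals_cnj_iff)
qed

lemma complex_hermitian_char_poly_splits:
  fixes A :: "complex mat"
  assumes "A \<in> carrier_mat n n"
  shows "\<exists>es. char_poly A = (\<Prod>e\<leftarrow>es. [:- e, 1:])"
  using char_poly_factorized[OF assms] by blast

text \<open>A real symmetric matrix is Hermitian over the complex numbers, so every complex root of
  its characteristic polynomial is real.\<close>

lemma real_hermitian_char_poly_splits:
  fixes A :: "real mat"
  assumes A: "A \<in> carrier_mat n n" "mat_adjoint A = A"
  shows "\<exists>es. char_poly A = (\<Prod>e\<leftarrow>es. [:- e, 1:])"
proof (rule real_rooted_poly_splits)
  show "monic (char_poly A)" using degree_monic_char_poly[OF A(1)] by simp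
  let ?C = "map_mat complex_of_real A"
  have C: "?C \<in> carrier_mat n n" using A by simp
  have "mat_adjoint ?C $$ (i, j) = ?C $$ (i, j)" if "i < n" "j < n" for i j
    using that A mat_adjoint_index[of i A j] by simp
  then have "mat_adjoint ?C = ?C" using A by (intro eq_matI) auto
  then show "z \<in> \<real>" if "poly (map_poly complex_of_real (char_poly A)) z = 0" for z
    using that hermitian_eigenvalue_real[OF C] eigenvalue_root_char_poly[OF C]
    by (simp add: of_real_hom.char_poly_hom[OF A(1)])
qed

text \<open>Not a type class, since class axioms may not mention \<^const>\<open>char_poly\<close>.\<close>

locale rc_field =
  fixes F :: "'a :: {conjugatable_ordered_field, real_normed_field} itself"
  assumes mult_conjugate_eq_norm: "(x :: 'a) * conjugate x = of_real ((norm x)\<^sup>2)"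
    and hermitian_char_poly_splits:
      "(A :: 'a mat) \<in> carrier_mat n n \<Longrightarrow> mat_adjoint A = A \<Longrightarrow>
        \<exists>es. char_poly A = (\<Prod>e\<leftarrow>es. [:- e, 1:])"

interpretation real_rc: rc_field "TYPE(real)"
  by standard (auto simp: power2_eq_square intro: real_hermitian_char_poly_splits)

interpretation complex_rc: rc_field "TYPE(complex)"
  by standard
    (auto simp: complex_norm_square intro: complex_hermitian_char_poly_splits
      simp del: of_real_power)

text \<open>The squared Euclidean norm as a real number, whereas \<open>x \<bullet>c x\<close> is a
  scalar of the field; \<open>cscalar_prod_self\<close> links the two.\<close>

definition vec_norm_sq :: "'a::real_normed_field vec \<Rightarrow> real" where
  "vec_norm_sq x = (\<Sum>i<dim_vec x. (norm (x $ i))\<^sup>2)"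

lemma vec_norm_sq_nonneg [simp]: "vec_norm_sq x \<ge> 0"
  unfolding vec_norm_sq_def by (rule sum_nonneg) simp

lemma vec_norm_sq_eq_0: "x \<in> carrier_vec n \<Longrightarrow> vec_norm_sq x = 0 \<longleftrightarrow> x = 0\<^sub>v n"
  unfolding vec_norm_sq_def by (auto simp: sum_nonneg_eq_0_iff)

section \<open>Unitary diagonalization of Hermitian matrices\<close>

context rc_field
begin

lemma cscalar_prod_self: "(x :: 'a vec) \<bullet>c x = of_real (vec_norm_sq x)"
  by (simp add: vec_norm_sq_def scalar_prod_def mult_conjugate_eq_norm lessThan_atLeast0)

text \<open>For \<open>r\<close> other than 0, cancel \<open>of_real r\<close> in
  \<open>mult_conjugate_eq_norm\<close>.\<close>

lemma conjugate_of_real [simp]: "conjugate (of_real r :: 'a) = of_real r"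
proof (cases "r = 0")
  case False
  have "(of_real r :: 'a) * conjugate (of_real r) = of_real r * of_real r"
    unfolding mult_conjugate_eq_norm by (simp add: power2_eq_square flip: of_real_mult)
  then show ?thesis using False by simp
qed simp

lemma conjugate_one [simp]: "conjugate (1 :: 'a) = 1"
  using conjugate_of_real[of 1] by simp

text \<open>Complete \<open>v\<close> to a basis, orthogonalize by Gram-Schmidt and normalize.
  Gram-Schmidt keeps its first vector, so column 0 is a multiple of \<open>v\<close>.\<close>

lemma unitary_completion:
  assumes v: "(v :: 'a vec) \<in> carrier_vec n" "v \<noteq> 0\<^sub>v n"
  shows "\<exists>U c. U \<in> carrier_mat n n \<and> mat_adjoint U * U = 1\<^sub>m n \<and> col U 0 = c \<cdot>\<^sub>v v"
proof -
  interpret cof_vec_space n "TYPE('a)" .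
  define ws where "ws = gram_schmidt n (basis_completion v)"
  note bc = basis_completion[OF v]
  note gs = gram_schmidt_result[OF bc(2,4,5) ws_def[unfolded gram_schmidt_def[symmetric]]]
  have len: "length ws = n" using gs(4) bc(6) by simp
  have n: "n > 0" using v by (cases n) auto
  obtain vs where vs: "basis_completion v = v # vs"
    using bc(6,7) n by (cases "basis_completion v") auto
  have hd: "ws ! 0 = v"
    using gram_schmidt_hd[OF v(1), of vs] len n unfolding ws_def vs
    by (metis hd_conv_nth less_numeral_extra(3) list.size(3))
  have w: "ws ! i \<in> carrier_vec n" if "i < n" for i using gs(3) len that by auto
  \<comment> \<open>The normalizing factor of column \<open>i\<close>; being real, it is fixed by
    conjugation.\<close>
  define s where "s i = (of_real (1 / sqrt (vec_norm_sq (ws ! i))) :: 'a)" for i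
  have cs: "conjugate (s i) = s i" for i unfolding s_def by (rule conjugate_of_real)
  define U where "U = mat n n (\<lambda>(i, j). s j * ws ! j $ i)"
  have U: "U \<in> carrier_mat n n" unfolding U_def by simp
  have colU: "col U j = s j \<cdot>\<^sub>v ws ! j" if "j < n" for j
    using that w[OF that] unfolding U_def by (intro eq_vecI) auto
  have s2: "s i * s i * of_real (vec_norm_sq (ws ! i)) = 1" if "i < n" for i
  proof -
    have "ws ! i \<bullet>c ws ! i \<noteq> 0" using corthogonalD[OF gs(2), of i i] that len by auto
    then have "vec_norm_sq (ws ! i) \<noteq> 0" unfolding cscalar_prod_self by simp
    then show ?thesis
      unfolding s_def of_real_mult[symmetric] by simp
  qed
  have "mat_adjoint U * U = 1\<^sub>m n"
  proof (rule eq_matI)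
    fix i j assume "i < dim_row (1\<^sub>m n)" "j < dim_col (1\<^sub>m n)"
    then have ij: "i < n" "j < n" by auto
    have "(mat_adjoint U * U) $$ (i, j) = col U j \<bullet>c col U i"
      using ij U by (auto simp: scalar_prod_def intro!: sum.cong)
    also have "\<dots> = s j * s i * (ws ! j \<bullet>c ws ! i)"
      unfolding colU[OF ij(1)] colU[OF ij(2)] conjugate_smult_vec cs
      using w[OF ij(1)] w[OF ij(2)]
      by (simp add: smult_scalar_prod_distrib[of _ n] scalar_prod_smult_distrib[of _ n])
    also have "\<dots> = (if i = j then 1 else 0)"
      using s2[OF ij(1)] corthogonalD[OF gs(2), of j i] ij len by (auto simp: cscalar_prod_self)
    finally show "(mat_adjoint U * U) $$ (i, j) = 1\<^sub>m n $$ (i, j)" using ij by simp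
  qed (use U in auto)
  then show ?thesis using U colU[OF n] hd by auto
qed

lemma unitary_right_inverse:
  assumes "(U :: 'a mat) \<in> carrier_mat n n" "mat_adjoint U * U = 1\<^sub>m n"
  shows "U * mat_adjoint U = 1\<^sub>m n"
  using mat_mult_left_right_inverse[OF mat_adjoint_carrier[OF assms(1)] assms] .

text \<open>Induction on the list of roots: a unitary \<open>U\<close> whose first column is an
  eigenvector for \<open>e\<close> splits off a 1 x 1 block, and the Hermitian remainder
  \<open>C\<close> has the roots \<open>es\<close>. The diagonal thus follows the order of the given
  list.\<close>

lemma spectral_theorem:
  fixes A :: "'a mat"
  assumes "A \<in> carrier_mat n n" "mat_adjoint A = A" "char_poly A = (\<Prod>e\<leftarrow>es. [:- e, 1:])"
  shows "\<exists>P \<in> carrier_mat n n. mat_adjoint P * P = 1\<^sub>m n \<and>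
    mat_adjoint P * A * P = mat n n (\<lambda>(i, j). if i = j then es ! i else 0)"
  using assms
proof (induction es arbitrary: n A)
  case Nil
  then have "n = 0" using degree_monic_char_poly[OF Nil(1)] by simp
  then show ?case by (intro bexI[of _ "1\<^sub>m 0"]) (auto intro!: eq_matI)
next
  case (Cons e es)
  note A = Cons.prems(1)
  have "poly (char_poly A) e = 0" unfolding Cons.prems by simp
  then have "eigenvalue A e" using eigenvalue_root_char_poly[OF A] by simp
  then obtain v where v: "v \<in> carrier_vec n" "v \<noteq> 0\<^sub>v n" "A *\<^sub>v v = e \<cdot>\<^sub>v v"
    unfolding eigenvalue_def eigenvector_def using A by auto
  have "n \<noteq> 0" using v by (cases n) auto
  then obtain k where n: "n = Suc k" by (cases n) auto
  obtain U c where U: "U \<in> carrier_mat n n" "mat_adjoint U * U = 1\<^sub>m n" "col U 0 = c \<cdot>\<^sub>v v"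
    using unitary_completion[OF v(1,2)] by blast
  note U' = mat_adjoint_carrier[OF U(1)]
  define B where "B = mat_adjoint U * A * U"
  have B: "B \<in> carrier_mat n n" unfolding B_def using U A by auto
  have hB: "mat_adjoint B = B"
    unfolding B_def mat_adjoint_mult[OF mult_carrier_mat[OF U' A] U(1)] mat_adjoint_mult[OF U' A]
      Cons.prems(2) by (simp add: assoc_mult_mat[OF U' A U(1)])
  \<comment> \<open>Column 0 of \<open>U\<close> is fixed by \<open>A\<close> up to the factor
    \<open>e\<close>, and \<open>mat_adjoint U\<close> sends it to the first unit vector.\<close>
  have B0: "B $$ (i, 0) = (if i = 0 then e else 0)" if i: "i < n" for i
  proof -
    have "B $$ (i, 0) = row (mat_adjoint U) i \<bullet> col (A * U) 0"
      unfolding B_def assoc_mult_mat[OF U' A U(1)] using i U U' A n by auto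
    also have "col (A * U) 0 = A *\<^sub>v col U 0" using col_mult2[OF A U(1)] n by auto
    also have "\<dots> = e \<cdot>\<^sub>v col U 0"
      unfolding U(3) using A v by (simp add: mult_mat_vec smult_smult_assoc mult.commute)
    also have "row (mat_adjoint U) i \<bullet> (e \<cdot>\<^sub>v col U 0) = e * (row (mat_adjoint U) i \<bullet> col U 0)"
      by (rule scalar_prod_smult_distrib[of _ n]) (use U(1) n in \<open>auto intro!: carrier_vecI\<close>)
    also have "row (mat_adjoint U) i \<bullet> col U 0 = (mat_adjoint U * U) $$ (i, 0)"
      using i U(1) n by auto
    finally show ?thesis unfolding U(2) using i n by auto
  qed
  \<comment> \<open>Since \<open>B\<close> is Hermitian, the zeros of column 0 reappear in row
    0.\<close>
  have B0': "B $$ (0, j) = 0" if "0 < j" "j < n" for j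
    using B0[OF that(2)] that hB B mat_adjoint_index[of 0 B j] by auto
  define C where "C = mat k k (\<lambda>(i, j). B $$ (Suc i, Suc j))"
  have C: "C \<in> carrier_mat k k" unfolding C_def by simp
  let ?e = "mat 1 1 (\<lambda>_. e)"
  have Bblock: "B = four_block_mat ?e (0\<^sub>m 1 k) (0\<^sub>m k 1) C"
    unfolding C_def using B B0 B0' n by (intro eq_matI) auto
  have "conjugate (B $$ (Suc j, Suc i)) = B $$ (Suc i, Suc j)" if "i < k" "j < k" for i j
    using that mat_adjoint_index[of "Suc i" B "Suc j"] B n unfolding hB by auto
  then have hC: "mat_adjoint C = C" unfolding C_def by (intro eq_matI) auto
  \<comment> \<open>Similarity preserves the characteristic polynomial; cancelling the factor of
    \<open>e\<close> leaves exactly the product over \<open>es\<close> for \<open>C\<close>, as the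
    induction hypothesis demands.\<close>
  have "similar_mat_wit B A (mat_adjoint U) U"
    by (rule similar_mat_witI[of _ _ n]) (use U B A unitary_right_inverse in \<open>auto simp: B_def\<close>)
  then have "char_poly B = char_poly A"
    by (intro char_poly_similar) (auto simp: similar_mat_def)
  moreover have "char_poly B = [:- e, 1:] * char_poly C"
  proof -
    have "char_poly B = char_poly ?e * char_poly C"
      unfolding Bblock by (rule char_poly_four_block_zeros_col) (use C in auto)
    also have "char_poly ?e = [:- e, 1:]"
      by (simp add: char_poly_defs det_def sign_def)
    finally show ?thesis .
  qed
  ultimately have "[:- e, 1:] * char_poly C = [:- e, 1:] * (\<Prod>e\<leftarrow>es. [:- e, 1:])"
    using Cons.prems(3) by simp
  then have "char_poly C = (\<Prod>e\<leftarrow>es. [:- e, 1:])"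
    by (metis mult_cancel_left pCons_eq_0_iff zero_neq_one)
  from Cons.IH[OF C hC this] obtain Q where Q: "Q \<in> carrier_mat k k"
    "mat_adjoint Q * Q = 1\<^sub>m k"
    "mat_adjoint Q * C * Q = mat k k (\<lambda>(i, j). if i = j then es ! i else 0)"
    by blast
  \<comment> \<open>\<open>V\<close> keeps the first coordinate and diagonalizes the block
    \<open>C\<close>; the unitary matrix sought is \<open>U * V\<close>.\<close>
  define V where "V = four_block_mat (1\<^sub>m 1) (0\<^sub>m 1 k) (0\<^sub>m k 1) Q"
  have V: "V \<in> carrier_mat n n" unfolding V_def n using Q(1) by auto
  have V': "mat_adjoint V = four_block_mat (1\<^sub>m 1) (0\<^sub>m 1 k) (0\<^sub>m k 1) (mat_adjoint Q)"
    unfolding V_def using Q(1) by (intro eq_matI) auto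
  have Q': "mat_adjoint Q \<in> carrier_mat k k" using Q by auto
  have "mat_adjoint V * V = four_block_mat (1\<^sub>m 1) (0\<^sub>m 1 k) (0\<^sub>m k 1) (mat_adjoint Q * Q)"
    unfolding V' unfolding V_def
    by (subst mult_four_block_mat[of _ 1 1 _ k _ k _ _ 1 _ k]) (use Q(1) Q' in auto)
  then have V1: "mat_adjoint V * V = 1\<^sub>m n" unfolding Q(2) n by (auto intro!: eq_matI)
  have "mat_adjoint V * B = four_block_mat ?e (0\<^sub>m 1 k) (0\<^sub>m k 1) (mat_adjoint Q * C)"
    unfolding V' Bblock
    by (subst mult_four_block_mat[of _ 1 1 _ k _ k _ _ 1 _ k]) (use Q(1) Q' C in auto)
  then have "mat_adjoint V * B * V = four_block_mat ?e (0\<^sub>m 1 k) (0\<^sub>m k 1) (mat_adjoint Q * C * Q)"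
    unfolding V_def
    by (simp, subst mult_four_block_mat[of _ 1 1 _ k _ k _ _ 1 _ k]) (use Q(1) Q' C in auto)
  also have "\<dots> = mat n n (\<lambda>(i, j). if i = j then (e # es) ! i else 0)"
    unfolding Q(3) n by (intro eq_matI) auto
  finally have V2: "mat_adjoint V * B * V = mat n n (\<lambda>(i, j). if i = j then (e # es) ! i else 0)" .
  define P where "P = U * V"
  have P: "P \<in> carrier_mat n n" unfolding P_def using U V by auto
  have P': "mat_adjoint P = mat_adjoint V * mat_adjoint U"
    unfolding P_def using mat_adjoint_mult[OF U(1) V] .
  note V'' = mat_adjoint_carrier[OF V]
  have "mat_adjoint P * P = mat_adjoint V * (mat_adjoint U * U) * V"
    unfolding P' unfolding P_def
    by (simp add: assoc_mult_mat[OF V'' U' mult_carrier_mat[OF U(1) V]] assoc_mult_mat[OF U' U(1) V]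
        assoc_mult_mat[OF V'' mult_carrier_mat[OF U' U(1)] V])
  then have "mat_adjoint P * P = 1\<^sub>m n" unfolding U(2) right_mult_one_mat[OF V''] V1 .
  moreover have "mat_adjoint P * A * P = mat_adjoint V * B * V"
    unfolding P' unfolding P_def B_def
    by (simp add: assoc_mult_mat[OF V'' U' A] assoc_mult_mat[OF U' A U(1)]
        assoc_mult_mat[OF V'' mult_carrier_mat[OF U' A] mult_carrier_mat[OF U(1) V]]
        assoc_mult_mat[OF U' A mult_carrier_mat[OF U(1) V]] assoc_mult_mat[OF A U(1) V]
        assoc_mult_mat[OF V'' mult_carrier_mat[OF U' mult_carrier_mat[OF A U(1)]] V]
        assoc_mult_mat[OF U' mult_carrier_mat[OF A U(1)] V])
  ultimately show ?case using P V2 by auto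
qed

text \<open>The vector \<open>z\<close> holds the coordinates of \<open>x\<close> in an orthonormal
  eigenbasis of \<open>mat_adjoint B * B\<close>. The change of basis preserves the norm and turns
  the quadratic form of this Gram matrix into a weighted sum of squares.\<close>

lemma gram_diagonalization:
  assumes B: "(B :: 'a mat) \<in> carrier_mat p q"
  shows "\<exists>es. length es = q \<and> char_poly (mat_adjoint B * B) = (\<Prod>e\<leftarrow>es. [:- e, 1:]) \<and>
    (\<forall>x \<in> carrier_vec q. \<exists>z \<in> carrier_vec q. vec_norm_sq x = vec_norm_sq (z :: 'a vec) \<and>
       vec_norm_sq (B *\<^sub>v x) = (\<Sum>i<q. norm (es ! i) * (norm (z $ i))\<^sup>2))"
proof -
  note B' = mat_adjoint_carrier[OF B]
  define H where "H = mat_adjoint B * B"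
  have H: "H \<in> carrier_mat q q" "mat_adjoint H = H"
    unfolding H_def using B by (auto simp: mat_adjoint_mult[OF B' B])
  obtain es where es: "char_poly H = (\<Prod>e\<leftarrow>es. [:- e, 1:])"
    using hermitian_char_poly_splits[OF H] by blast
  have len: "length es = q"
    using degree_monic_char_poly[OF H(1)] degree_linear_factors[of uminus es] unfolding es by simp
  obtain P where P: "P \<in> carrier_mat q q" "mat_adjoint P * P = 1\<^sub>m q"
    and D: "mat_adjoint P * H * P = mat q q (\<lambda>(i, j). if i = j then es ! i else 0)"
    using spectral_theorem[OF H es] by blast
  note P' = mat_adjoint_carrier[OF P(1)]
  \<comment> \<open>Each eigenvalue is a diagonal entry of the Gram matrix of \<open>B * P\<close>,
    hence the squared norm of a column and a nonnegative real.\<close>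
  have norm_e: "of_real (norm (es ! i)) = es ! i" if i: "i < q" for i
  proof -
    have BP: "B * P \<in> carrier_mat p q" using B P by auto
    have "mat_adjoint P * H * P = mat_adjoint (B * P) * (B * P)"
      unfolding H_def mat_adjoint_mult[OF B P(1)] using B P(1) B' P' H(1)[unfolded H_def]
      by (simp add: assoc_mult_mat[of _ q q _ p _ q] assoc_mult_mat[of _ q p _ q _ q]
          assoc_mult_mat[of _ q q _ q _ q])
    then have "es ! i = (mat_adjoint (B * P) * (B * P)) $$ (i, i)"
      unfolding D using i by (metis (mono_tags, lifting) case_prod_conv index_mat(1))
    also have "\<dots> = col (B * P) i \<bullet>c col (B * P) i"
      using BP i by (auto simp: scalar_prod_def mult.commute intro!: sum.cong)
    finally show ?thesis unfolding cscalar_prod_self by simp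
  qed
  have "\<exists>z \<in> carrier_vec q. vec_norm_sq x = vec_norm_sq (z :: 'a vec) \<and>
       vec_norm_sq (B *\<^sub>v x) = (\<Sum>i<q. norm (es ! i) * (norm (z $ i))\<^sup>2)"
    if x: "x \<in> carrier_vec q" for x
  proof -
    define z where "z = mat_adjoint P *\<^sub>v x"
    have z: "z \<in> carrier_vec q" unfolding z_def using P' x by auto
    have Pz: "P *\<^sub>v z = x"
      unfolding z_def using x unitary_right_inverse[OF P]
      by (simp flip: assoc_mult_mat_vec[OF P(1) P' x])
    have "x \<bullet>c x = z \<bullet>c z"
      using mult_mat_vec_adjoint_scalar_prod[OF P(1) z x] unfolding Pz z_def[symmetric] .
    then have norm_z: "vec_norm_sq x = vec_norm_sq z" unfolding cscalar_prod_self by simp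
    have "of_real (vec_norm_sq (B *\<^sub>v x)) = (B *\<^sub>v x) \<bullet>c (B *\<^sub>v x)"
      by (simp add: cscalar_prod_self)
    also have "\<dots> = x \<bullet>c (H *\<^sub>v x)"
      using mult_mat_vec_adjoint_scalar_prod[OF B x, of "B *\<^sub>v x"] B x
      unfolding H_def assoc_mult_mat_vec[OF B' B x] by simp
    also have "\<dots> = z \<bullet>c (mat_adjoint P *\<^sub>v (H *\<^sub>v (P *\<^sub>v z)))"
      using mult_mat_vec_adjoint_scalar_prod[OF P(1) z, of "H *\<^sub>v x"] H x unfolding Pz by simp
    also have "mat_adjoint P *\<^sub>v (H *\<^sub>v (P *\<^sub>v z)) = (mat_adjoint P * H * P) *\<^sub>v z"
      unfolding assoc_mult_mat_vec[OF mult_carrier_mat[OF P' H(1)] P(1) z]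
        assoc_mult_mat_vec[OF P' H(1) mult_mat_vec_carrier[OF P(1) z]] ..
    also have "\<dots> = vec q (\<lambda>i. of_real (norm (es ! i)) * z $ i)"
      unfolding D using z
      by (intro eq_vecI) (auto simp: scalar_prod_def norm_e if_distrib[of "\<lambda>a. a * _"] cong: if_cong)
    also have "z \<bullet>c \<dots> = (\<Sum>i<q. of_real (norm (es ! i)) * (z $ i * conjugate (z $ i)))"
      using z by (auto simp: scalar_prod_def conjugate_dist_mul lessThan_atLeast0 mult_ac intro!: sum.cong)
    also have "\<dots> = of_real (\<Sum>i<q. norm (es ! i) * (norm (z $ i))\<^sup>2)"
      by (simp add: mult_conjugate_eq_norm)
    finally have "vec_norm_sq (B *\<^sub>v x) = (\<Sum>i<q. norm (es ! i) * (norm (z $ i))\<^sup>2)"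
      by (simp only: of_real_eq_iff)
    with z norm_z show ?thesis by (intro bexI[of _ z] conjI)
  qed
  then show ?thesis using len es unfolding H_def by blast
qed

end

section \<open>Singular values\<close>

text \<open>With x for \<open>[:0, 1:]\<close>, the block matrix \<open>M\<close> with rows (x I, A)
  and (B, I) becomes block triangular after multiplication by \<open>N1\<close> or
  \<open>N2\<close>. The determinants of the two products both compute \<open>det M\<close>, the
  second one times \<open>x^q\<close>.\<close>

lemma char_poly_mult_swap:
  fixes A B :: "'a::field mat"
  assumes A: "A \<in> carrier_mat p q" and B: "B \<in> carrier_mat q p"
  shows "[:0, 1:] ^ q * char_poly (A * B) = [:0, 1:] ^ p * char_poly (B * A)"
proof -
  let ?C = "map_mat (\<lambda>a. [:a:])"
  let ?X = "\<lambda>n. [:0, 1:] \<cdot>\<^sub>m 1\<^sub>m n :: 'a poly mat"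
  have cA: "?C A \<in> carrier_mat p q" and cB: "?C B \<in> carrier_mat q p" using A B by auto
  have AB: "?C A * ?C B \<in> carrier_mat p p" and BA: "?C B * ?C A \<in> carrier_mat q q"
    using cA cB by auto
  define M where "M = four_block_mat (?X p) (?C A) (?C B) (1\<^sub>m q)"
  define N1 where "N1 = four_block_mat (1\<^sub>m p) (0\<^sub>m p q) (- ?C B) (1\<^sub>m q)"
  define N2 where "N2 = four_block_mat (1\<^sub>m p) (- ?C A) (0\<^sub>m q p) (?X q)"
  have M: "M \<in> carrier_mat (p + q) (p + q)" and N1: "N1 \<in> carrier_mat (p + q) (p + q)"
    and N2: "N2 \<in> carrier_mat (p + q) (p + q)"
    unfolding M_def N1_def N2_def by auto
  have cp: "char_poly (Y * Z) = det (?X m + (- (?C Y * ?C Z)))"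
    if "Y \<in> carrier_mat m l" "Z \<in> carrier_mat l m" for Y Z :: "'a mat" and m l
  proof -
    have "char_poly_matrix (Y * Z) = ?X m + (- ?C (Y * Z))"
      unfolding char_poly_matrix_def using that by (intro eq_matI) auto
    then show ?thesis unfolding char_poly_def map_poly_mult(1)[OF that] by simp
  qed
  note mult_block = mult_four_block_mat[of _ p p _ q _ q _ _ p _ q]
  have "?C B * 1\<^sub>m p + 1\<^sub>m q * - ?C B = 0\<^sub>m q p"
    unfolding right_mult_one_mat[OF cB] left_mult_one_mat[OF uminus_carrier_mat[OF cB]]
    by (rule eq_matI) (use cB in auto)
  moreover have "?C A * - ?C B = - (?C A * ?C B)"
    using cA cB by (intro uminus_mult_right_mat) auto
  ultimately have "M * N1 = four_block_mat (?X p + (- (?C A * ?C B))) (?C A) (0\<^sub>m q p) (1\<^sub>m q)"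
    unfolding M_def N1_def using cA cB by (subst mult_block) auto
  then have "det (M * N1) = char_poly (A * B)"
    using det_four_block_mat_lower_left_zero[of "?X p + (- (?C A * ?C B))" p "?C A" q "0\<^sub>m q p" "1\<^sub>m q"]
      cA AB by (simp add: cp[OF A B])
  moreover have "det N1 = 1"
    unfolding N1_def by (subst det_four_block_mat_upper_right_zero[of _ p _ q]) (use cB in auto)
  ultimately have 1: "det M = char_poly (A * B)" using det_mult[OF M N1] by simp
  have "?X p * - ?C A = - ([:0, 1:] \<cdot>\<^sub>m ?C A)"
    using cA mult_smult_assoc_mat[of "1\<^sub>m p" p p "- ?C A" q] by auto
  moreover have "?C A * ?X q = [:0, 1:] \<cdot>\<^sub>m ?C A"
    using cA mult_smult_distrib[of "?C A" p q "1\<^sub>m q" q] by simp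
  ultimately have "?X p * - ?C A + ?C A * ?X q = 0\<^sub>m p q"
    using cA by simp
  moreover have "?C B * - ?C A + 1\<^sub>m q * ?X q = ?X q + (- (?C B * ?C A))"
    using cA cB BA by (subst uminus_mult_right_mat) (auto intro: comm_add_mat)
  ultimately have "M * N2 = four_block_mat (?X p) (0\<^sub>m p q) (?C B) (?X q + (- (?C B * ?C A)))"
    unfolding M_def N2_def using cA cB by (subst mult_block) auto
  then have 2: "det (M * N2) = [:0, 1:] ^ p * char_poly (B * A)"
    unfolding cp[OF B A]
    using det_four_block_mat_upper_right_zero[of "?X p" p "0\<^sub>m p q" q "?C B" "?X q + (- (?C B * ?C A))"]
        cB BA by simp
  have "det N2 = [:0, 1:] ^ q"
    unfolding N2_def by (subst det_four_block_mat_lower_left_zero[of _ p _ q]) (use cA in auto)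
  then show ?thesis using 1 2 det_mult[OF M N2] by (simp add: mult.commute)
qed

definition sing_mset :: "'a::{conjugatable_field, real_normed_field} mat \<Rightarrow> real multiset" where
  "sing_mset A = image_mset (\<lambda>e. sqrt (norm e)) (proots (char_poly (mat_adjoint A * A)))"

lemma proots_linear_factors: "proots (\<Prod>e\<leftarrow>es. [:- e, 1:]) = mset (es :: 'a::idom list)"
proof (induction es)
  case (Cons e es)
  have "(\<Prod>e\<leftarrow>es. [:- e, 1:]) \<noteq> (0 :: 'a poly)"
    by (induction es) (auto simp del: mult_pCons_left)
  then show ?case using Cons by (simp add: proots_mult del: mult_pCons_left)
qed simp

context rc_field
begin

lemma size_sing_mset: "(B :: 'a mat) \<in> carrier_mat p q \<Longrightarrow> size (sing_mset B) = q"
  using gram_diagonalization[of B p q] unfolding sing_mset_def by (auto simp: proots_linear_factors)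

text \<open>In the eigenbasis coordinates \<open>z\<close>, the squared norm of
  \<open>B *\<^sub>v x\<close> weights each squared entry of \<open>z\<close> by a squared singular
  value; replacing each weight by \<open>c\<^sup>2\<close> gives the bound.\<close>

lemma sing_mset_lower_bound:
  assumes B: "(B :: 'a mat) \<in> carrier_mat p q" and x: "x \<in> carrier_vec q"
    and c: "\<And>s. s \<in># sing_mset B \<Longrightarrow> c \<le> s" "0 \<le> c"
  shows "c\<^sup>2 * vec_norm_sq x \<le> vec_norm_sq (B *\<^sub>v x)"
proof -
  obtain es z where es: "length es = q" "char_poly (mat_adjoint B * B) = (\<Prod>e\<leftarrow>es. [:- e, 1:])"
    and z: "(z :: 'a vec) \<in> carrier_vec q" "vec_norm_sq x = vec_norm_sq z"
      "vec_norm_sq (B *\<^sub>v x) = (\<Sum>i<q. norm (es ! i) * (norm (z $ i))\<^sup>2)"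
    using gram_diagonalization[OF B] x by blast
  have "c\<^sup>2 \<le> norm (es ! i)" if "i < q" for i
  proof -
    have "c \<le> sqrt (norm (es ! i))"
      using that es c(1)[of "sqrt (norm (es ! i))"] by (auto simp: sing_mset_def proots_linear_factors)
    then have "c\<^sup>2 \<le> (sqrt (norm (es ! i)))\<^sup>2" using c(2) by (rule power_mono)
    then show ?thesis by simp
  qed
  moreover have "vec_norm_sq z = (\<Sum>i<q. (norm (z $ i))\<^sup>2)"
    using z(1) by (simp add: vec_norm_sq_def)
  ultimately show ?thesis
    unfolding z(2,3) by (auto simp: sum_distrib_left intro!: sum_mono mult_right_mono)
qed

lemma sing_mset_upper_bound:
  assumes B: "(B :: 'a mat) \<in> carrier_mat p q" and x: "x \<in> carrier_vec q"
    and c: "\<And>s. s \<in># sing_mset B \<Longrightarrow> s \<le> c"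
  shows "vec_norm_sq (B *\<^sub>v x) \<le> c\<^sup>2 * vec_norm_sq x"
proof -
  obtain es z where es: "length es = q" "char_poly (mat_adjoint B * B) = (\<Prod>e\<leftarrow>es. [:- e, 1:])"
    and z: "(z :: 'a vec) \<in> carrier_vec q" "vec_norm_sq x = vec_norm_sq z"
      "vec_norm_sq (B *\<^sub>v x) = (\<Sum>i<q. norm (es ! i) * (norm (z $ i))\<^sup>2)"
    using gram_diagonalization[OF B] x by blast
  have "norm (es ! i) \<le> c\<^sup>2" if "i < q" for i
  proof -
    have "sqrt (norm (es ! i)) \<le> c"
      using that es c[of "sqrt (norm (es ! i))"] by (auto simp: sing_mset_def proots_linear_factors)
    then show ?thesis by (rule sqrt_le_D)
  qed
  moreover have "vec_norm_sq z = (\<Sum>i<q. (norm (z $ i))\<^sup>2)"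
    using z(1) by (simp add: vec_norm_sq_def)
  ultimately show ?thesis
    unfolding z(2,3) by (auto simp: sum_distrib_left intro!: sum_mono mult_right_mono)
qed

text \<open>By \<open>char_poly_mult_swap\<close> the two characteristic polynomials differ by the
  factor \<open>[:0, 1:] ^ (q - p)\<close>, whose only root is 0.\<close>

lemma sing_mset_wide:
  assumes B: "(B :: 'a mat) \<in> carrier_mat p q" and "p \<le> q"
  shows "sing_mset B = replicate_mset (q - p) 0 + sing_mset (mat_adjoint B)"
proof -
  note B' = mat_adjoint_carrier[OF B]
  let ?K = "char_poly (B * mat_adjoint B)" and ?G = "char_poly (mat_adjoint B * B)"
  have "?K \<noteq> 0" using degree_monic_char_poly[OF mult_carrier_mat[OF B B']] by auto
  have "[:0, 1:] ^ q = [:0, 1:] ^ p * ([:0, 1:] :: 'a poly) ^ (q - p)"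
    using \<open>p \<le> q\<close> by (simp flip: power_add)
  then have "[:0, 1:] ^ p * ?G = [:0, 1:] ^ p * ([:0, 1:] ^ (q - p) * ?K)"
    using char_poly_mult_swap[OF B B'] by (simp only: mult.assoc)
  then have "?G = [:0, 1:] ^ (q - p) * ?K"
    by (subst (asm) mult_left_cancel) simp_all
  moreover have "repeat_mset (q - p) {#0 :: 'a#} = replicate_mset (q - p) 0"
    by (rule multiset_eqI) simp
  ultimately have "proots ?G = replicate_mset (q - p) 0 + proots ?K"
    using \<open>?K \<noteq> 0\<close> proots_linear_factor[of "0 :: 'a"]
    by (simp only: proots_mult proots_power minus_zero)
      (simp add: proots_mult proots_power)
  then show ?thesis unfolding sing_mset_def by simp
qed

lemma sing_mset_nonneg: "s \<in># sing_mset B \<Longrightarrow> 0 \<le> s"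
  unfolding sing_mset_def by auto

lemma singular_values_tall:
  assumes "(B :: 'a mat) \<in> carrier_mat p q" "q \<le> p"
  shows "singular_values B = rev (sorted_list_of_multiset (sing_mset B))"
proof -
  have "length (sorted_list_of_multiset (sing_mset B)) = q"
    using size_sing_mset[OF assms(1)] by (metis mset_sorted_list_of_multiset size_mset)
  then show ?thesis
    using assms unfolding singular_values_def sing_mset_def[symmetric] by simp
qed

text \<open>Reduces wide matrices to tall ones, where nothing is truncated.\<close>

lemma singular_values_adjoint:
  assumes B: "(B :: 'a mat) \<in> carrier_mat p q" and "p \<le> q"
  shows "singular_values B = singular_values (mat_adjoint B)"
proof -
  note B' = mat_adjoint_carrier[OF B]
  let ?L = "sorted_list_of_multiset (sing_mset (mat_adjoint B))"
  have len: "length ?L = p"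
    using size_sing_mset[OF B'] by (metis mset_sorted_list_of_multiset size_mset)
  \<comment> \<open>As singular values are nonnegative, the extra zeros may stand first in
    increasing order; after reversal they are the tail that \<open>take\<close> removes.\<close>
  have sorted: "sorted (replicate (q - p) 0 @ ?L)"
    using sing_mset_nonneg by (auto simp: sorted_append)
  have "mset (replicate (q - p) 0 @ ?L) = sing_mset B"
    unfolding sing_mset_wide[OF assms] by simp
  then have "sorted_list_of_multiset (sing_mset B) = sort (replicate (q - p) 0 @ ?L)"
    by (simp only: sorted_list_of_multiset_mset flip: \<open>mset _ = _\<close>)
  also have "\<dots> = replicate (q - p) 0 @ ?L" by (rule sorted_sort_id[OF sorted])
  finally have "sorted_list_of_multiset (sing_mset B) = replicate (q - p) 0 @ ?L" .
  then show ?thesis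
    unfolding singular_values_tall[OF B' \<open>p \<le> q\<close>]
    using B \<open>p \<le> q\<close> len unfolding singular_values_def sing_mset_def[symmetric] by simp
qed

lemma sing_val_tall_bounds:
  assumes B: "(B :: 'a mat) \<in> carrier_mat p q" and q: "0 < q" "q \<le> p" and s: "s \<in># sing_mset B"
  shows "sing_val q B \<le> s" "s \<le> sing_val 1 B"
proof -
  let ?L = "sorted_list_of_multiset (sing_mset B)"
  have len: "length ?L = q"
    using size_sing_mset[OF B] by (metis mset_sorted_list_of_multiset size_mset)
  obtain i where i: "i < q" "s = ?L ! i"
    using s len by (metis in_set_conv_nth set_sorted_list_of_multiset)
  \<comment> \<open>Numbering starts at 1 and the list is reversed, so number \<open>q\<close> is
    the head of the increasing list and number 1 its last entry.\<close>
  have "sing_val q B = ?L ! 0" "sing_val 1 B = ?L ! (q - 1)"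
    unfolding sing_val_def singular_values_tall[OF B q(2)] using len q by (simp_all add: rev_nth)
  then show "sing_val q B \<le> s" "s \<le> sing_val 1 B"
    using i len q sorted_nth_mono[OF sorted_sorted_list_of_multiset[of "sing_mset B"]] by auto
qed

lemma sing_val_nonneg_tall:
  assumes B: "(B :: 'a mat) \<in> carrier_mat p q" and q: "0 < q" "q \<le> p"
  shows "0 \<le> sing_val q B"
proof -
  let ?L = "sorted_list_of_multiset (sing_mset B)"
  have len: "length ?L = q"
    using size_sing_mset[OF B] by (metis mset_sorted_list_of_multiset size_mset)
  have "sing_val q B = ?L ! 0"
    unfolding sing_val_def singular_values_tall[OF B q(2)] using len q by (simp add: rev_nth)
  then have "sing_val q B \<in># sing_mset B" using len q by (metis nth_mem set_sorted_list_of_multiset)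
  then show ?thesis by (rule sing_mset_nonneg)
qed

lemma least_sing_val_bound:
  assumes B: "(B :: 'a mat) \<in> carrier_mat p q" and q: "0 < q" "q \<le> p" and x: "x \<in> carrier_vec q"
  shows "(sing_val q B)\<^sup>2 * vec_norm_sq x \<le> vec_norm_sq (B *\<^sub>v x)"
  using sing_mset_lower_bound[OF B x] sing_val_tall_bounds(1)[OF B q] sing_val_nonneg_tall[OF B q]
  by blast

lemma sing_val_adjoint:
  "(B :: 'a mat) \<in> carrier_mat p q \<Longrightarrow> p \<le> q \<Longrightarrow> sing_val i B = sing_val i (mat_adjoint B)"
  unfolding sing_val_def by (simp add: singular_values_adjoint)

lemma norm_conjugate [simp]: "norm (conjugate a :: 'a) = norm a"
proof (cases "a = 0")
  case False
  have "norm (a * conjugate a) = (norm a)\<^sup>2" unfolding mult_conjugate_eq_norm by (simp add: norm_power)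
  then show ?thesis using False by (simp add: norm_mult power2_eq_square)
qed simp

lemma vec_Cauchy_Schwarz:
  assumes "(x :: 'a vec) \<in> carrier_vec n" "y \<in> carrier_vec n"
  shows "(norm (x \<bullet>c y))\<^sup>2 \<le> vec_norm_sq x * vec_norm_sq y"
proof -
  have "norm (x \<bullet>c y) \<le> (\<Sum>i<n. norm (x $ i) * norm (y $ i))"
    using assms norm_sum[of "\<lambda>i. x $ i * conjugate (y $ i)" "{..<n}"]
    by (simp add: scalar_prod_def norm_mult lessThan_atLeast0)
  then have "(norm (x \<bullet>c y))\<^sup>2 \<le> (\<Sum>i<n. norm (x $ i) * norm (y $ i))\<^sup>2"
    by (intro power_mono) auto
  also have "\<dots> \<le> (\<Sum>i<n. (norm (x $ i))\<^sup>2) * (\<Sum>i<n. (norm (y $ i))\<^sup>2)"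
    by (rule Cauchy_Schwarz_ineq_sum)
  finally show ?thesis using assms by (simp add: vec_norm_sq_def)
qed

text \<open>For \<open>u = mat_adjoint B *\<^sub>v y\<close>, the squared norm of \<open>u\<close>
  is the inner product of \<open>y\<close> with \<open>B *\<^sub>v u\<close>. Cauchy-Schwarz and the
  bound for \<open>B\<close> leave one factor \<open>vec_norm_sq u\<close> to cancel.\<close>

lemma adjoint_bound:
  assumes B: "(B :: 'a mat) \<in> carrier_mat p q"
    and "0 \<le> c" and bound: "\<And>x. x \<in> carrier_vec q \<Longrightarrow> vec_norm_sq (B *\<^sub>v x) \<le> c * vec_norm_sq x"
    and y: "y \<in> carrier_vec p"
  shows "vec_norm_sq (mat_adjoint B *\<^sub>v y) \<le> c * vec_norm_sq y"
proof -
  note B' = mat_adjoint_carrier[OF B]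
  define u where "u = mat_adjoint B *\<^sub>v y"
  have u: "u \<in> carrier_vec q" unfolding u_def using B' y by simp
  show ?thesis
  proof (cases "vec_norm_sq u = 0")
    case True
    then show ?thesis using \<open>0 \<le> c\<close> unfolding u_def by simp
  next
    case False
    then have pos: "vec_norm_sq u > 0" using vec_norm_sq_nonneg[of u] by linarith
    have "of_real (vec_norm_sq u) = y \<bullet>c (B *\<^sub>v u)"
      using mult_mat_vec_adjoint_scalar_prod[OF B' y u] by (simp add: cscalar_prod_self flip: u_def)
    then have "(vec_norm_sq u)\<^sup>2 = (norm (y \<bullet>c (B *\<^sub>v u)))\<^sup>2"
      by (metis norm_of_real power2_abs)
    also have "\<dots> \<le> vec_norm_sq y * vec_norm_sq (B *\<^sub>v u)"
      using B u y by (intro vec_Cauchy_Schwarz) auto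
    also have "\<dots> \<le> vec_norm_sq y * (c * vec_norm_sq u)"
      using bound[OF u] by (intro mult_left_mono) auto
    finally have "vec_norm_sq u * vec_norm_sq u \<le> (c * vec_norm_sq y) * vec_norm_sq u"
      by (simp add: power2_eq_square mult_ac)
    then show ?thesis unfolding u_def[symmetric] using pos by simp
  qed
qed

text \<open>The largest singular value bounds a tall matrix directly. For a wide one it bounds the
  adjoint, which is tall, and \<open>adjoint_bound\<close> carries this back.\<close>

lemma norm2_bound:
  assumes B: "(B :: 'a mat) \<in> carrier_mat p q" and "0 < p" "0 < q" and x: "x \<in> carrier_vec q"
  shows "vec_norm_sq (B *\<^sub>v x) \<le> (norm2 B)\<^sup>2 * vec_norm_sq x"
proof (cases "q \<le> p")
  case True
  then show ?thesis
    using sing_mset_upper_bound[OF B x] sing_val_tall_bounds(2)[OF B] assms(3)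
    unfolding norm2_def by blast
next
  case False
  note B' = mat_adjoint_carrier[OF B]
  have "vec_norm_sq (mat_adjoint B *\<^sub>v y) \<le> (norm2 B)\<^sup>2 * vec_norm_sq y"
    if "y \<in> carrier_vec p" for y
    using sing_mset_upper_bound[OF B' that] sing_val_tall_bounds(2)[OF B'] assms(2) False
      sing_val_adjoint[OF B, of 1]
    unfolding norm2_def by simp
  from adjoint_bound[OF B' _ this x] show ?thesis by simp
qed

end

section \<open>Full rank\<close>

lemma mat_adjoint_minus:
  fixes A B :: "'a::conjugatable_field mat"
  assumes "A \<in> carrier_mat p q" "B \<in> carrier_mat p q"
  shows "mat_adjoint (A - B) = mat_adjoint A - mat_adjoint B"
proof (rule eq_matI)
  fix i j assume "i < dim_row (mat_adjoint A - mat_adjoint B)" "j < dim_col (mat_adjoint A - mat_adjoint B)"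
  then have "i < q" "j < p" using assms by auto
  then show "mat_adjoint (A - B) $$ (i, j) = (mat_adjoint A - mat_adjoint B) $$ (i, j)"
    using assms conjugate_dist_add[of "A $$ (j, i)" "- B $$ (j, i)"] by (simp add: conjugate_neg)
qed (use assms in auto)

lemma minus_zero_vec: "(u :: 'a::group_add vec) \<in> carrier_vec n \<Longrightarrow> u - 0\<^sub>v n = u"
  by (intro eq_vecI) auto

lemma mult_mat_vec_index_sum:
  assumes "A \<in> carrier_mat p q" "x \<in> carrier_vec q" "i < p"
  shows "(A *\<^sub>v x) $ i = (\<Sum>j<q. A $$ (i, j) * x $ j)"
  using assms by (auto simp: scalar_prod_def lessThan_atLeast0 intro!: sum.cong)

lemma mat_rank_eq_dim_col:
  fixes A :: "'a::field mat"
  assumes A: "A \<in> carrier_mat p q"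
    and inj: "\<And>x. x \<in> carrier_vec q \<Longrightarrow> A *\<^sub>v x = 0\<^sub>v p \<Longrightarrow> x = 0\<^sub>v q"
  shows "mat_rank A = q"
proof -
  interpret vec_space "TYPE('a)" p .
  \<comment> \<open>Linear independence concerns the set of columns, so repetitions are excluded
    first: equal columns \<open>i\<close> and \<open>j\<close> would put the difference of two unit
    vectors into the kernel.\<close>
  have "distinct (cols A)"
  proof (rule ccontr)
    assume "\<not> distinct (cols A)"
    then obtain i j where ij: "i < q" "j < q" "i \<noteq> j" "col A i = col A j"
      using A unfolding distinct_conv_nth by auto
    have unit: "A *\<^sub>v unit_vec q l = col A l" if "l < q" for l
      using A that by (intro eq_vecI) auto
    have "A *\<^sub>v (unit_vec q i - unit_vec q j) = col A i - col A j"
      using mult_minus_distrib_mat_vec[OF A unit_vec_carrier unit_vec_carrier] ij by (simp add: unit)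
    then have "A *\<^sub>v (unit_vec q i - unit_vec q j) = 0\<^sub>v p"
      using A ij by (auto intro!: eq_vecI)
    then have "unit_vec q i - unit_vec q j = (0\<^sub>v q :: 'a vec)"
      by (rule inj[rotated]) simp
    then have "(unit_vec q i - unit_vec q j :: 'a vec) $ i = 0" using ij by simp
    then show False using ij by simp
  qed
  then have "rank A = q"
    using inj lin_depE[OF A _ \<open>distinct (cols A)\<close>] lin_indpt_full_rank[OF A] by metis
  then show ?thesis using A unfolding mat_rank_def by simp
qed

lemma mat_rank_eq_dim_row:
  fixes A :: "'a::field mat"
  assumes A: "A \<in> carrier_mat p q"
    and surj: "\<And>y. y \<in> carrier_vec p \<Longrightarrow> \<exists>x \<in> carrier_vec q. A *\<^sub>v x = y"
  shows "mat_rank A = p"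
proof -
  interpret vec_space "TYPE('a)" p .
  have sub: "set (cols A) \<subseteq> carrier_vec p" using A cols_dim[of A] by simp
  have "y \<in> span (set (cols A))" if y: "y \<in> carrier_vec p" for y
    using surj[OF y] col_space_eq[OF A] A y unfolding col_space_def by auto
  moreover have "span (set (cols A)) \<subseteq> carrier_vec p" using span_is_subset2[OF sub] by simp
  ultimately have "span (set (cols A)) = carrier_vec p" by auto
  moreover have "vs (carrier_vec p) = module_vec TYPE('a) p" by (simp add: module_vec_def)
  ultimately have "rank A = p" using dim_is_n by (simp only: rank_def)
  then show ?thesis using A unfolding mat_rank_def by simp
qed

context rc_field
begin

text \<open>A trivial kernel of the adjoint makes \<open>K = A * mat_adjoint A\<close> invertible,
  and then \<open>mat_adjoint A\<close> times the inverse of \<open>K\<close> is a right inverse of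
  \<open>A\<close>.\<close>

lemma mat_rank_eq_dim_row_adjoint:
  assumes A: "(A :: 'a mat) \<in> carrier_mat p q"
    and inj: "\<And>y. y \<in> carrier_vec p \<Longrightarrow> mat_adjoint A *\<^sub>v y = 0\<^sub>v q \<Longrightarrow> y = 0\<^sub>v p"
  shows "mat_rank A = p"
proof (rule mat_rank_eq_dim_row[OF A])
  fix y :: "'a vec" assume y: "y \<in> carrier_vec p"
  note A' = mat_adjoint_carrier[OF A]
  define K where "K = A * mat_adjoint A"
  have K: "K \<in> carrier_mat p p" unfolding K_def using A by auto
  have "u = 0\<^sub>v p" if u: "u \<in> carrier_vec p" "K *\<^sub>v u = 0\<^sub>v p" for u
  proof (rule inj[OF u(1)])
    have w: "mat_adjoint A *\<^sub>v u \<in> carrier_vec q" using A' u by auto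
    have "A *\<^sub>v (mat_adjoint A *\<^sub>v u) = 0\<^sub>v p"
      using u(2) unfolding K_def assoc_mult_mat_vec[OF A A' u(1)] .
    then have "(mat_adjoint A *\<^sub>v u) \<bullet>c (mat_adjoint A *\<^sub>v u) = 0"
      using mult_mat_vec_adjoint_scalar_prod[OF A' u(1) w] u(1) by simp
    then show "mat_adjoint A *\<^sub>v u = 0\<^sub>v q" using w by simp
  qed
  then have "det K \<noteq> 0" using det_0_iff_vec_prod_zero_field[OF K] by auto
  then obtain L where L: "L \<in> carrier_mat p p" "K * L = 1\<^sub>m p"
    using det_non_zero_imp_unit[OF K] unfolding Units_def by (auto simp: ring_mat_def)
  have Ly: "L *\<^sub>v y \<in> carrier_vec p" using L y by auto
  have "A *\<^sub>v (mat_adjoint A *\<^sub>v (L *\<^sub>v y)) = K *\<^sub>v (L *\<^sub>v y)"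
    unfolding K_def assoc_mult_mat_vec[OF A A' Ly] ..
  also have "\<dots> = y" using L y by (simp flip: assoc_mult_mat_vec[OF K L(1) y])
  finally show "\<exists>x \<in> carrier_vec q. A *\<^sub>v x = y"
    using A' Ly by (intro bexI[of _ "mat_adjoint A *\<^sub>v (L *\<^sub>v y)"]) auto
qed

lemma norm2_nonneg:
  assumes B: "(B :: 'a mat) \<in> carrier_mat p q" and "0 < p" "0 < q"
  shows "0 \<le> norm2 B"
proof -
  have tall: "0 \<le> sing_val 1 C" if C: "C \<in> carrier_mat k l" "0 < l" "l \<le> k" for C :: "'a mat" and k l
  proof -
    obtain s where s: "s \<in># sing_mset C"
      using size_sing_mset[OF C(1)] C(2) by (metis multiset_nonemptyE not_less_zero size_empty)
    show ?thesis using sing_mset_nonneg[OF s] sing_val_tall_bounds(2)[OF C s] by linarith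
  qed
  show ?thesis
  proof (cases "q \<le> p")
    case True
    then show ?thesis unfolding norm2_def using tall[OF B] assms by simp
  next
    case False
    then show ?thesis
      unfolding norm2_def using tall[OF mat_adjoint_carrier[OF B]] assms sing_val_adjoint[OF B, of 1] by simp
  qed
qed

lemma least_sing_val_adjoint_bound:
  assumes B: "(B :: 'a mat) \<in> carrier_mat p q" and p: "0 < p" "p \<le> q" and y: "y \<in> carrier_vec p"
  shows "(sing_val p B)\<^sup>2 * vec_norm_sq y \<le> vec_norm_sq (mat_adjoint B *\<^sub>v y)"
  using least_sing_val_bound[OF mat_adjoint_carrier[OF B] p y] sing_val_adjoint[OF B p(2)] by simp

end

section \<open>Sylvester matrices\<close>

text \<open>The entries of \<open>S\<^sub>k(P)\<close> do not depend on \<open>k\<close>.\<close>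

definition sylvester_entry :: "nat \<Rightarrow> 'a::field poly mat \<Rightarrow> nat \<Rightarrow> nat \<Rightarrow> 'a" where
  "sylvester_entry d P r c =
     (let i = r div dim_row P; j = c div dim_col P in
      if j \<le> i \<and> i - j \<le> d
      then coeff (P $$ (r mod dim_row P, c mod dim_col P)) (i - j) else 0)"

lemma sylvester_carrier [simp]:
  "sylvester d k P \<in> carrier_mat ((k + d) * dim_row P) (k * dim_col P)"
  unfolding sylvester_def by simp

lemma dim_sylvester [simp]:
  "dim_row (sylvester d k P) = (k + d) * dim_row P" "dim_col (sylvester d k P) = k * dim_col P"
  unfolding sylvester_def by simp_all

lemma sylvester_index:
  assumes "r < (k + d) * dim_row P" "c < k * dim_col P"
  shows "sylvester d k P $$ (r, c) = sylvester_entry d P r c"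
proof -
  have "dim_row P > 0" "dim_col P > 0" using assms by (auto intro: gr0I)
  then show ?thesis
    using assms unfolding sylvester_def sylvester_entry_def coeff_mat_def by (simp add: Let_def)
qed

text \<open>Block Toeplitz structure: a step along a block diagonal keeps the difference of the
  block indices.\<close>

lemma sylvester_entry_shift:
  assumes "dim_row P > 0" "dim_col P > 0"
  shows "sylvester_entry d P (r + dim_row P) (c + dim_col P) = sylvester_entry d P r c"
  using assms unfolding sylvester_entry_def by (simp add: Let_def)

lemma sylvester_entry_above:
  assumes "dim_col P > 0" "r < j * dim_row P" "j * dim_col P \<le> c"
  shows "sylvester_entry d P r c = 0"
proof -
  have "r div dim_row P < j" using assms by (simp add: less_mult_imp_div_less)
  moreover have "j \<le> c div dim_col P" using assms by (simp add: less_eq_div_iff_mult_less_eq)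
  ultimately show ?thesis unfolding sylvester_entry_def by (simp add: Let_def)
qed

lemma sylvester_entry_below:
  assumes "dim_row P > 0" "c < j * dim_col P" "(j + d) * dim_row P \<le> r"
  shows "sylvester_entry d P r c = 0"
proof -
  have "c div dim_col P < j" using assms by (simp add: less_mult_imp_div_less)
  moreover have "j + d \<le> r div dim_row P" using assms by (simp add: less_eq_div_iff_mult_less_eq)
  ultimately show ?thesis unfolding sylvester_entry_def by (simp add: Let_def)
qed

lemma sylvester_entry_block:
  assumes "dim_row P > 0" "dim_col P > 0"
  shows "sylvester_entry d P (r + j * dim_row P) (c + j * dim_col P) = sylvester_entry d P r c"
proof (induction j)
  case (Suc j)
  then show ?case
    using sylvester_entry_shift[OF assms, of d "r + j * dim_row P" "c + j * dim_col P"]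
    by (simp add: add_ac)
qed simp

section \<open>Transfer of trivial kernels between Sylvester indices\<close>

lemma sylvester_kernel_antimono:
  assumes P: "dim_row P > 0" and k: "k \<le> l"
    and inj: "\<And>x. x \<in> carrier_vec (l * dim_col P) \<Longrightarrow>
      sylvester d l P *\<^sub>v x = 0\<^sub>v ((l + d) * dim_row P) \<Longrightarrow> x = 0\<^sub>v (l * dim_col P)"
    and x: "x \<in> carrier_vec (k * dim_col P)"
      "sylvester d k P *\<^sub>v x = 0\<^sub>v ((k + d) * dim_row P)"
  shows "x = 0\<^sub>v (k * dim_col P)"
proof -
  let ?N = "dim_col P" and ?m = "dim_row P"
  have kl: "k * ?N \<le> l * ?N" using k by simp
  \<comment> \<open>Padding by zeros keeps a null vector: the first \<open>k\<close> block columns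
    of the larger matrix are those of the smaller one above zero block rows.\<close>
  define z where "z = vec (l * ?N) (\<lambda>c. if c < k * ?N then x $ c else 0)"
  have z_index: "z $ c = (if c < k * ?N then x $ c else 0)" if "c < l * ?N" for c
    using that unfolding z_def by simp
  have "sylvester d l P *\<^sub>v z = 0\<^sub>v ((l + d) * ?m)"
  proof (rule eq_vecI)
    fix r assume "r < dim_vec (0\<^sub>v ((l + d) * ?m) :: 'a vec)"
    then have r: "r < (l + d) * ?m" by simp
    have "(sylvester d l P *\<^sub>v z) $ r = (\<Sum>c<l * ?N. sylvester_entry d P r c * z $ c)"
      using r by (subst mult_mat_vec_index_sum[OF sylvester_carrier])
        (auto simp: z_def sylvester_index intro!: sum.cong)
    also have "\<dots> = (\<Sum>c<k * ?N. sylvester_entry d P r c * x $ c)"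
    proof (rule sum.mono_neutral_cong_right)
      show "{..<k * ?N} \<subseteq> {..<l * ?N}" using kl by (simp only: lessThan_subset_iff)
      show "sylvester_entry d P r c * z $ c = sylvester_entry d P r c * x $ c" if "c \<in> {..<k * ?N}" for c
        using that z_index[OF less_le_trans[OF _ kl]] by simp
    qed (auto simp: z_index)
    also have "\<dots> = 0"
    proof (cases "r < (k + d) * ?m")
      case True
      have "(\<Sum>c<k * ?N. sylvester_entry d P r c * x $ c) = (sylvester d k P *\<^sub>v x) $ r"
        using True x(1) by (subst mult_mat_vec_index_sum[OF sylvester_carrier])
          (auto simp: sylvester_index intro!: sum.cong)
      then show ?thesis using x(2) True by simp
    next
      case False
      then show ?thesis using sylvester_entry_below[OF P] by (intro sum.neutral) auto
    qed
    finally show "(sylvester d l P *\<^sub>v z) $ r = 0\<^sub>v ((l + d) * ?m) $ r" using r by simp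
  qed (use sylvester_carrier[of d l P] in auto)
  then have z0: "z = 0\<^sub>v (l * ?N)" by (intro inj) (auto simp: z_def)
  show ?thesis
  proof (rule eq_vecI)
    fix c assume "c < dim_vec (0\<^sub>v (k * ?N) :: 'a vec)"
    then show "x $ c = 0\<^sub>v (k * ?N) $ c"
      using arg_cong[OF z0, of "\<lambda>v. v $ c"] kl unfolding z_def by simp
  qed (use x in auto)
qed

lemma sylvester_adjoint_mult_index:
  fixes P :: "'a::conjugatable_field poly mat"
  assumes "y \<in> carrier_vec ((k + d) * dim_row P)" "c < k * dim_col P"
  shows "(mat_adjoint (sylvester d k P) *\<^sub>v y) $ c =
    (\<Sum>r<(k + d) * dim_row P. conjugate (sylvester_entry d P r c) * y $ r)"
proof -
  note S = sylvester_carrier[of d k P]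
  have "mat_adjoint (sylvester d k P) $$ (c, r) = conjugate (sylvester_entry d P r c)"
    if "r < (k + d) * dim_row P" for r
    using that assms(2) S by (simp add: sylvester_index)
  then show ?thesis
    by (subst mult_mat_vec_index_sum[OF mat_adjoint_carrier[OF S] assms]) (auto intro!: sum.cong)
qed

text \<open>The matrix for \<open>Suc k\<close> contains the one for \<open>k\<close> as its upper
  left and as its lower right corner. Its first \<open>k\<close> block columns vanish in the last
  block row, and its last \<open>k\<close> block columns vanish in the first block row.\<close>

lemma sylvester_left_kernel_Suc:
  fixes P :: "'a::conjugatable_field poly mat"
  assumes P: "dim_row P > 0" "dim_col P > 0" and kd: "k + d > 0"
    and inj: "\<And>y. y \<in> carrier_vec ((k + d) * dim_row P) \<Longrightarrow>
      mat_adjoint (sylvester d k P) *\<^sub>v y = 0\<^sub>v (k * dim_col P) \<Longrightarrow> y = 0\<^sub>v ((k + d) * dim_row P)"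
    and y: "y \<in> carrier_vec ((Suc k + d) * dim_row P)"
      "mat_adjoint (sylvester d (Suc k) P) *\<^sub>v y = 0\<^sub>v (Suc k * dim_col P)"
  shows "y = 0\<^sub>v ((Suc k + d) * dim_row P)"
proof -
  let ?N = "dim_col P" and ?m = "dim_row P" and ?F = "sylvester_entry d P"
  let ?p = "(k + d) * ?m"
  have p: "(Suc k + d) * ?m = ?p + ?m" by simp
  have *: "(\<Sum>r<?p + ?m. conjugate (?F r c) * y $ r) = 0" if "c < Suc k * ?N" for c
    using sylvester_adjoint_mult_index[OF y(1) that] y(2) that by (simp add: add.commute)
  \<comment> \<open>\<open>y1\<close> drops the last block of \<open>y\<close>, and
    \<open>y2\<close> drops the first; both are left null vectors for \<open>k\<close>.\<close>
  define y1 where "y1 = vec ?p (\<lambda>r. y $ r)"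
  define y2 where "y2 = vec ?p (\<lambda>r. y $ (r + ?m))"
  have "y1 = 0\<^sub>v ?p"
  proof (rule inj)
    show "mat_adjoint (sylvester d k P) *\<^sub>v y1 = 0\<^sub>v (k * ?N)"
    proof (rule eq_vecI)
      fix c assume "c < dim_vec (0\<^sub>v (k * ?N) :: 'a vec)"
      then have c: "c < k * ?N" by simp
      have "(mat_adjoint (sylvester d k P) *\<^sub>v y1) $ c = (\<Sum>r<?p. conjugate (?F r c) * y $ r)"
        using c by (subst sylvester_adjoint_mult_index) (auto simp: y1_def)
      also have "\<dots> = (\<Sum>r<?p + ?m. conjugate (?F r c) * y $ r)"
        by (rule sum.mono_neutral_left) (use sylvester_entry_below[OF P(1) c] in auto)
      finally show "(mat_adjoint (sylvester d k P) *\<^sub>v y1) $ c = 0\<^sub>v (k * ?N) $ c"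
        using *[of c] c by simp
    qed (use sylvester_carrier[of d k P] in auto)
  qed (simp add: y1_def)
  have "y2 = 0\<^sub>v ?p"
  proof (rule inj)
    show "mat_adjoint (sylvester d k P) *\<^sub>v y2 = 0\<^sub>v (k * ?N)"
    proof (rule eq_vecI)
      fix c assume "c < dim_vec (0\<^sub>v (k * ?N) :: 'a vec)"
      then have c: "c < k * ?N" by simp
      have "(mat_adjoint (sylvester d k P) *\<^sub>v y2) $ c =
          (\<Sum>r<?p. conjugate (?F (r + ?m) (c + ?N)) * y $ (r + ?m))"
        using c by (subst sylvester_adjoint_mult_index) (auto simp: y2_def sylvester_entry_shift[OF P])
      also have "\<dots> = (\<Sum>r\<in>{?m..<?p + ?m}. conjugate (?F r (c + ?N)) * y $ r)"
        by (rule sum.reindex_bij_witness[of _ "\<lambda>r. r - ?m" "\<lambda>r. r + ?m"]) auto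
      also have "\<dots> = (\<Sum>r<?p + ?m. conjugate (?F r (c + ?N)) * y $ r)"
        by (rule sum.mono_neutral_left) (use sylvester_entry_above[OF P(2), of _ 1] in auto)
      finally show "(mat_adjoint (sylvester d k P) *\<^sub>v y2) $ c = 0\<^sub>v (k * ?N) $ c"
        using *[of "c + ?N"] c by simp
    qed (use sylvester_carrier[of d k P] in auto)
  qed (simp add: y2_def)
  have "y $ r = 0" if r: "r < ?p + ?m" for r
  proof (cases "r < ?p")
    case True
    then show ?thesis using arg_cong[OF \<open>y1 = 0\<^sub>v ?p\<close>, of "\<lambda>v. v $ r"] by (simp add: y1_def)
  next
    case False
    \<comment> \<open>With at least two blocks in \<open>y\<close>, the block missing from
      \<open>y1\<close> is visible in \<open>y2\<close>.\<close>
    have "?m \<le> ?p" using kd by (cases "k + d") auto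
    then have "r - ?m < ?p" "r = r - ?m + ?m" using False r by linarith+
    then show ?thesis
      using arg_cong[OF \<open>y2 = 0\<^sub>v ?p\<close>, of "\<lambda>v. v $ (r - ?m)"] by (simp add: y2_def)
  qed
  then show ?thesis using y(1) by (intro eq_vecI) (auto simp: add.commute)
qed

lemma sylvester_left_kernel_mono:
  fixes P :: "'a::conjugatable_field poly mat"
  assumes P: "dim_row P > 0" "dim_col P > 0" and k: "k > 0" "k \<le> l"
    and inj: "\<And>y. y \<in> carrier_vec ((k + d) * dim_row P) \<Longrightarrow>
      mat_adjoint (sylvester d k P) *\<^sub>v y = 0\<^sub>v (k * dim_col P) \<Longrightarrow> y = 0\<^sub>v ((k + d) * dim_row P)"
    and y: "y \<in> carrier_vec ((l + d) * dim_row P)"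
      "mat_adjoint (sylvester d l P) *\<^sub>v y = 0\<^sub>v (l * dim_col P)"
  shows "y = 0\<^sub>v ((l + d) * dim_row P)"
  using k(2) y
proof (induction l arbitrary: y rule: dec_induct)
  case base
  then show ?case by (rule inj)
next
  case (step l)
  show ?case
    by (rule sylvester_left_kernel_Suc[OF P _ step.IH step.prems]) (use step.hyps k in auto)
qed

section \<open>Perturbation bounds for Sylvester matrices\<close>

context rc_field
begin

text \<open>The factor \<open>real k\<close> counts the blocks of the image, one for each window of
  \<open>y\<close>. The adjoint is the convenient side, since each of its output blocks depends on a
  single window.\<close>

lemma sylvester_diff_adjoint_bound:
  fixes P Q :: "'a poly mat"
  assumes dims: "dim_row P = m" "dim_col P = q" "dim_row Q = m" "dim_col Q = q" "m > 0" "q > 0"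
    and y: "y \<in> carrier_vec ((k + d) * m)"
  shows "vec_norm_sq (mat_adjoint (sylvester d k P - sylvester d k Q) *\<^sub>v y)
    \<le> real k * (norm2 (sylvester d 1 P - sylvester d 1 Q))\<^sup>2 * vec_norm_sq y"
proof -
  define G where "G r c = sylvester_entry d P r c - sylvester_entry d Q r c" for r c
  define D where "D l = sylvester d l P - sylvester d l Q" for l
  define \<nu> where "\<nu> = norm2 (D 1)"
  have D: "D l \<in> carrier_mat ((l + d) * m) (l * q)" for l
    unfolding D_def using sylvester_carrier[of d l P] sylvester_carrier[of d l Q] dims by auto
  note D' = mat_adjoint_carrier[OF D]
  have D_index: "(mat_adjoint (D l) *\<^sub>v z) $ c = (\<Sum>r<(l + d) * m. conjugate (G r c) * z $ r)"
    if "z \<in> carrier_vec ((l + d) * m)" "c < l * q" for l z c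
  proof -
    have "mat_adjoint (D l) $$ (c, r) = conjugate (G r c)" if "r < (l + d) * m" for r
      using that \<open>c < l * q\<close> D[of l] dims by (simp add: D_def G_def sylvester_index)
    then show ?thesis
      by (subst mult_mat_vec_index_sum[OF D' that]) (auto intro!: sum.cong)
  qed
  have G_block: "G (r + j * m) (b + j * q) = G r b" for r b j
    using dims sylvester_entry_block[of P d r j b] sylvester_entry_block[of Q d r j b]
    unfolding G_def by simp
  have G_outside: "G r (b + j * q) = 0" if "b < q" "r < j * m \<or> (j + 1 + d) * m \<le> r" for r b j
    using that(2)
  proof
    assume "r < j * m"
    then show ?thesis
      using dims sylvester_entry_above[of P r j "b + j * q" d] sylvester_entry_above[of Q r j "b + j * q" d]
      unfolding G_def by simp
  next
    assume "(j + 1 + d) * m \<le> r"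
    moreover have "b + j * q < (j + 1) * q" using that(1) by simp
    ultimately show ?thesis
      using dims sylvester_entry_below[of P "b + j * q" "j + 1" d r]
        sylvester_entry_below[of Q "b + j * q" "j + 1" d r]
      unfolding G_def by simp
  qed
  \<comment> \<open>The window of block rows \<open>j\<close> to \<open>j + d\<close>, outside of
    which block column \<open>j\<close> vanishes.\<close>
  define yb where "yb j = vec ((1 + d) * m) (\<lambda>r. y $ (r + j * m))" for j
  have in_range: "(j + 1 + d) * m \<le> (k + d) * m" if "j < k" for j
    using that by (intro mult_le_mono1) simp
  have range_sub: "{j * m..<(j + 1 + d) * m} \<subseteq> {..<(k + d) * m}" if "j < k" for j
    using in_range[OF that] by (meson atLeastLessThan_iff lessThan_iff less_le_trans subsetI)
  have block: "(mat_adjoint (D k) *\<^sub>v y) $ (b + j * q) = (mat_adjoint (D 1) *\<^sub>v yb j) $ b"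
    if j: "j < k" and b: "b < q" for j b
  proof -
    have "b + j * q < (j + 1) * q" using b by simp
    also have "\<dots> \<le> k * q" using j by (intro mult_le_mono1) simp
    finally have c: "b + j * q < k * q" .
    have "(mat_adjoint (D k) *\<^sub>v y) $ (b + j * q)
        = (\<Sum>r<(k + d) * m. conjugate (G r (b + j * q)) * y $ r)"
      using D_index[OF y c] .
    also have "\<dots> = (\<Sum>r\<in>{j * m..<(j + 1 + d) * m}. conjugate (G r (b + j * q)) * y $ r)"
    proof (rule sum.mono_neutral_right[OF finite_lessThan range_sub[OF j]], intro ballI)
      fix r assume "r \<in> {..<(k + d) * m} - {j * m..<(j + 1 + d) * m}"
      then have "r < j * m \<or> (j + 1 + d) * m \<le> r"
        by (metis DiffD2 atLeastLessThan_iff not_less)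
      then show "conjugate (G r (b + j * q)) * y $ r = 0"
        by (simp only: G_outside[OF b] conjugate_zero mult_zero_left)
    qed
    also have "\<dots> = (\<Sum>r<(1 + d) * m. conjugate (G (r + j * m) (b + j * q)) * y $ (r + j * m))"
      by (rule sum.reindex_bij_witness[of _ "\<lambda>r. r + j * m" "\<lambda>r. r - j * m"])
        (auto simp: algebra_simps)
    also have "\<dots> = (mat_adjoint (D 1) *\<^sub>v yb j) $ b"
      using b by (subst D_index) (auto simp: yb_def G_block)
    finally show ?thesis .
  qed
  have yb_le: "vec_norm_sq (yb j) \<le> vec_norm_sq y" if j: "j < k" for j
  proof -
    have "vec_norm_sq (yb j) = (\<Sum>r<(1 + d) * m. (norm (y $ (r + j * m)))\<^sup>2)"
      by (simp add: vec_norm_sq_def yb_def)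
    also have "\<dots> = (\<Sum>r\<in>{j * m..<(j + 1 + d) * m}. (norm (y $ r))\<^sup>2)"
      by (rule sum.reindex_bij_witness[of _ "\<lambda>r. r - j * m" "\<lambda>r. r + j * m"])
        (auto simp: algebra_simps)
    also have "\<dots> \<le> (\<Sum>r<(k + d) * m. (norm (y $ r))\<^sup>2)"
      by (rule sum_mono2[OF finite_lessThan range_sub[OF j]]) simp
    finally show ?thesis using y by (simp add: vec_norm_sq_def)
  qed
  have D1_bound: "vec_norm_sq (mat_adjoint (D 1) *\<^sub>v z) \<le> \<nu>\<^sup>2 * vec_norm_sq z"
    if "z \<in> carrier_vec ((1 + d) * m)" for z
    using dims that unfolding \<nu>_def by (intro adjoint_bound[OF D]) (auto intro!: norm2_bound[OF D])
  have "vec_norm_sq (mat_adjoint (D k) *\<^sub>v y) = (\<Sum>c<k * q. (norm ((mat_adjoint (D k) *\<^sub>v y) $ c))\<^sup>2)"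
    using D[of k] by (simp add: vec_norm_sq_def)
  also have "\<dots> = (\<Sum>j<k. \<Sum>c\<in>{j * q..<j * q + q}. (norm ((mat_adjoint (D k) *\<^sub>v y) $ c))\<^sup>2)"
    by (rule sum.nat_group[symmetric])
  also have "\<dots> = (\<Sum>j<k. vec_norm_sq (mat_adjoint (D 1) *\<^sub>v yb j))"
  proof (rule sum.cong[OF refl])
    fix j assume "j \<in> {..<k}"
    then have j: "j < k" by simp
    have "(\<Sum>c\<in>{j * q..<j * q + q}. (norm ((mat_adjoint (D k) *\<^sub>v y) $ c))\<^sup>2)
        = (\<Sum>b<q. (norm ((mat_adjoint (D k) *\<^sub>v y) $ (b + j * q)))\<^sup>2)"
      by (rule sum.reindex_bij_witness[of _ "\<lambda>b. b + j * q" "\<lambda>c. c - j * q"]) auto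
    also have "\<dots> = (\<Sum>b<q. (norm ((mat_adjoint (D 1) *\<^sub>v yb j) $ b))\<^sup>2)"
      using block[OF j] by simp
    also have "\<dots> = vec_norm_sq (mat_adjoint (D 1) *\<^sub>v yb j)"
      using D[of 1] by (simp add: vec_norm_sq_def)
    finally show "(\<Sum>c\<in>{j * q..<j * q + q}. (norm ((mat_adjoint (D k) *\<^sub>v y) $ c))\<^sup>2)
        = vec_norm_sq (mat_adjoint (D 1) *\<^sub>v yb j)" .
  qed
  also have "\<dots> \<le> (\<Sum>j<k. \<nu>\<^sup>2 * vec_norm_sq y)"
  proof (rule sum_mono)
    fix j assume "j \<in> {..<k}"
    then have "\<nu>\<^sup>2 * vec_norm_sq (yb j) \<le> \<nu>\<^sup>2 * vec_norm_sq y"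
      using yb_le by (intro mult_left_mono) auto
    then show "vec_norm_sq (mat_adjoint (D 1) *\<^sub>v yb j) \<le> \<nu>\<^sup>2 * vec_norm_sq y"
      using D1_bound[of "yb j"] by (simp add: yb_def)
  qed
  finally show ?thesis unfolding \<nu>_def D_def by (simp add: mult.assoc)
qed

text \<open>Applied with \<open>s\<close> the squared norm of a null vector of the perturbed matrix:
  a positive \<open>s\<close> could be cancelled, giving \<sigma> at most \<open>sqrt k\<close>
  times \<nu>.\<close>

lemma perturbation_gap:
  assumes "0 \<le> \<nu>" "\<nu> < \<sigma> / sqrt (real k)" "k > 0" "\<sigma>\<^sup>2 * s \<le> real k * \<nu>\<^sup>2 * s" "0 \<le> s"
  shows "s = 0"
proof (rule ccontr)
  assume "s \<noteq> 0"
  then have "\<sigma>\<^sup>2 \<le> real k * \<nu>\<^sup>2" using assms(4,5) by simp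
  moreover have "sqrt (real k) * \<nu> < \<sigma>" using assms(2,3) by (simp add: field_simps)
  then have "(sqrt (real k) * \<nu>)\<^sup>2 < \<sigma>\<^sup>2" using assms(1) by (intro power_strict_mono) auto
  ultimately show False by (simp add: power_mult_distrib)
qed

context
  fixes P Q :: "'a poly mat" and m q d k :: nat
  assumes dims: "dim_row P = m" "dim_col P = q" "dim_row Q = m" "dim_col Q = q" "m > 0" "q > 0"
    and k: "k > 0"
begin

lemma norm2_sylvester_diff_nonneg: "0 \<le> norm2 (sylvester d 1 P - sylvester d 1 Q)"
  by (rule norm2_nonneg[of _ "(1 + d) * m" q]) (use dims in auto)

text \<open>On a left null vector of the matrix of \<open>Q\<close>, the adjoint of the difference
  acts like that of the matrix of \<open>P\<close>. The least singular value bounds its image from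
  below, the perturbation norm from above.\<close>

lemma perturbed_left_kernel_trivial:
  assumes wide: "(k + d) * m \<le> k * q"
    and close: "norm2 (sylvester d 1 P - sylvester d 1 Q)
      < sing_val ((k + d) * m) (sylvester d k P) / sqrt (real k)"
    and y: "y \<in> carrier_vec ((k + d) * m)" "mat_adjoint (sylvester d k Q) *\<^sub>v y = 0\<^sub>v (k * q)"
  shows "y = 0\<^sub>v ((k + d) * m)"
proof -
  have SP: "sylvester d k P \<in> carrier_mat ((k + d) * m) (k * q)"
    and SQ: "sylvester d k Q \<in> carrier_mat ((k + d) * m) (k * q)"
    using sylvester_carrier[of d k P] sylvester_carrier[of d k Q] dims by auto
  have "mat_adjoint (sylvester d k P - sylvester d k Q)
      = mat_adjoint (sylvester d k P) - mat_adjoint (sylvester d k Q)"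
    by (rule mat_adjoint_minus[OF SP SQ])
  then have "mat_adjoint (sylvester d k P - sylvester d k Q) *\<^sub>v y
      = mat_adjoint (sylvester d k P) *\<^sub>v y"
    using minus_mult_distrib_mat_vec[OF mat_adjoint_carrier[OF SP] mat_adjoint_carrier[OF SQ] y(1)] y(2)
      mult_mat_vec_carrier[OF mat_adjoint_carrier[OF SP] y(1)]
    by (simp add: minus_zero_vec)
  then have "(sing_val ((k + d) * m) (sylvester d k P))\<^sup>2 * vec_norm_sq y
      \<le> real k * (norm2 (sylvester d 1 P - sylvester d 1 Q))\<^sup>2 * vec_norm_sq y"
    using least_sing_val_adjoint_bound[OF SP _ wide y(1)] sylvester_diff_adjoint_bound[OF dims y(1)] dims k
    by simp
  from perturbation_gap[OF norm2_sylvester_diff_nonneg close k this]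
  show ?thesis using vec_norm_sq_eq_0[OF y(1)] by simp
qed

lemma perturbed_kernel_trivial:
  assumes tall: "k * q \<le> (k + d) * m"
    and close: "norm2 (sylvester d 1 P - sylvester d 1 Q)
      < sing_val (k * q) (sylvester d k P) / sqrt (real k)"
    and x: "x \<in> carrier_vec (k * q)" "sylvester d k Q *\<^sub>v x = 0\<^sub>v ((k + d) * m)"
  shows "x = 0\<^sub>v (k * q)"
proof -
  have SP: "sylvester d k P \<in> carrier_mat ((k + d) * m) (k * q)"
    and SQ: "sylvester d k Q \<in> carrier_mat ((k + d) * m) (k * q)"
    using sylvester_carrier[of d k P] sylvester_carrier[of d k Q] dims by auto
  let ?D = "sylvester d k P - sylvester d k Q"
  have D: "?D \<in> carrier_mat ((k + d) * m) (k * q)" by (rule minus_carrier_mat[OF SQ])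
  have "?D *\<^sub>v x = sylvester d k P *\<^sub>v x"
    using minus_mult_distrib_mat_vec[OF SP SQ x(1)] x(2) mult_mat_vec_carrier[OF SP x(1)]
    by (simp add: minus_zero_vec)
  \<comment> \<open>The bound is known for the adjoint of \<open>?D\<close>; taking adjoints once
    more gives it for \<open>?D\<close>.\<close>
  moreover have "vec_norm_sq (?D *\<^sub>v x)
      \<le> real k * (norm2 (sylvester d 1 P - sylvester d 1 Q))\<^sup>2 * vec_norm_sq x"
    using adjoint_bound[OF mat_adjoint_carrier[OF D] _ sylvester_diff_adjoint_bound[OF dims] x(1)] by simp
  ultimately have "(sing_val (k * q) (sylvester d k P))\<^sup>2 * vec_norm_sq x
      \<le> real k * (norm2 (sylvester d 1 P - sylvester d 1 Q))\<^sup>2 * vec_norm_sq x"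
    using least_sing_val_bound[OF SP _ tall x(1)] dims k by simp
  from perturbation_gap[OF norm2_sylvester_diff_nonneg close k this]
  show ?thesis using vec_norm_sq_eq_0[OF x(1)] by simp
qed

end

text \<open>Serves both parts of the theorem: the disjuncts of \<open>col\<close> are the case
  \<open>t = 0\<close>, the case of index 1, and the additional bound of part (a).\<close>

lemma full_sylvester_rank_perturbation:
  fixes P Q :: "'a poly mat"
  assumes P: "P \<in> polymats m (m + n) d" and Q: "Q \<in> polymats m (m + n) d"
    and pos: "m > 0" "k > 0" and wide: "m * d \<le> n * k" and tall: "n * (k - 1) < m * d"
    and row: "norm2 (sylvester d 1 P - sylvester d 1 Q)
      < sing_val ((k + d) * m) (sylvester d k P) / sqrt (real k)"
    and col: "n * k = m * d \<or> k = 1 \<or>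
      norm2 (sylvester d 1 P - sylvester d 1 Q)
        < sing_val ((k - 1) * (m + n)) (sylvester d (k - 1) P) / sqrt (real (k - 1))"
  shows "full_sylvester_rank d Q"
proof -
  have dims: "dim_row P = m" "dim_col P = m + n" "dim_row Q = m" "dim_col Q = m + n" "m > 0" "m + n > 0"
    using P Q pos unfolding polymats_def by auto
  \<comment> \<open>The common term \<open>l * m\<close> cancels, so the shape at index
    \<open>l\<close> depends only on \<open>m * d\<close> and \<open>n * l\<close>.\<close>
  have wide_iff: "(l + d) * m \<le> l * (m + n) \<longleftrightarrow> m * d \<le> n * l" for l
    by (simp add: algebra_simps)
  have S: "sylvester d l Q \<in> carrier_mat ((l + d) * m) (l * (m + n))" for l
    using sylvester_carrier[of d l Q] dims by simp
  have "mat_rank (sylvester d l Q) = min ((l + d) * m) (l * (m + n))" if l: "l \<ge> 1" for l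
  proof (cases "k \<le> l")
    case True
    then have "m * d \<le> n * l" using wide mult_le_mono2[of k l n] by linarith
    moreover have "mat_rank (sylvester d l Q) = (l + d) * m"
    proof (rule mat_rank_eq_dim_row_adjoint[OF S])
      fix y :: "'a vec"
      assume "y \<in> carrier_vec ((l + d) * m)" "mat_adjoint (sylvester d l Q) *\<^sub>v y = 0\<^sub>v (l * (m + n))"
      then show "y = 0\<^sub>v ((l + d) * m)"
        using sylvester_left_kernel_mono[of Q k l d y] dims pos True wide
          perturbed_left_kernel_trivial[OF dims pos(2) _ row] by (simp add: wide_iff)
    qed
    ultimately show ?thesis using wide_iff[of l] by simp
  next
    case False
    then have k1: "k > 1" and lk: "l \<le> k - 1" using l by auto
    have nl: "n * l < m * d" using lk tall mult_le_mono2[of l "k - 1" n] by linarith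
    \<comment> \<open>The largest index whose Sylvester matrix has no more columns than rows; all
      indices below \<open>k\<close> inherit a trivial kernel from it.\<close>
    define K where "K = (if n * k = m * d then k else k - 1)"
    have K: "K > 0" "l \<le> K" "n * K \<le> m * d"
      using k1 lk tall by (auto simp: K_def)
    have close: "norm2 (sylvester d 1 P - sylvester d 1 Q)
      < sing_val (K * (m + n)) (sylvester d K P) / sqrt (real K)"
    proof (cases "n * k = m * d")
      case True
      \<comment> \<open>For a square matrix the smallest singular value has the same number counted
        by rows or by columns, so the row hypothesis also covers the columns.\<close>
      then have "(k + d) * m = k * (m + n)" by (simp add: algebra_simps)
      then show ?thesis using row True by (simp add: K_def)
    next
      case False
      \<comment> \<open>The disjunct \<open>k = 1\<close> is excluded because \<open>l\<close> is
        positive and below \<open>k\<close>.\<close>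
      then show ?thesis using col k1 by (auto simp: K_def)
    qed
    have "K * (m + n) \<le> (K + d) * m" using K(3) by (simp add: algebra_simps)
    note trivial = perturbed_kernel_trivial[OF dims K(1) this close]
    have "mat_rank (sylvester d l Q) = l * (m + n)"
    proof (rule mat_rank_eq_dim_col[OF S])
      fix x :: "'a vec"
      assume "x \<in> carrier_vec (l * (m + n))" "sylvester d l Q *\<^sub>v x = 0\<^sub>v ((l + d) * m)"
      then show "x = 0\<^sub>v (l * (m + n))"
        using sylvester_kernel_antimono[of Q l K d x] dims K(2) trivial by simp
    qed
    then show ?thesis using nl wide_iff[of l] by simp
  qed
  then show ?thesis unfolding full_sylvester_rank_def dims by blast
qed

end

theorem theorem6p6:
  fixes m n d k' :: nat and t :: int
  assumes "m > 0" and "n > 0" and "d > 0"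
    and "k' = nat \<lceil>real (m * d) / real n\<rceil>"
    and "t = int n * int k' - int m * int d"
  shows "0 \<le> t \<and> t < int n \<and>
    (\<forall>M \<in> (polymats m (m + n) d :: real poly mat set). full_sylvester_rank d M \<longrightarrow>
       (k' > 1 \<and> t > 0 \<longrightarrow>
         (\<forall>M' \<in> (polymats m (m + n) d :: real poly mat set).
            norm2 (sylvester d 1 M - sylvester d 1 M')
              < min (sing_val ((k' - 1) * (m + n)) (sylvester d (k' - 1) M) / sqrt (real (k' - 1)))
                    (sing_val ((k' + d) * m) (sylvester d k' M) / sqrt (real k')) \<longrightarrow>
            full_sylvester_rank d M')) \<and>
       (k' = 1 \<or> t = 0 \<longrightarrow>
         (\<forall>M' \<in> (polymats m (m + n) d :: real poly mat set).
            norm2 (sylvester d 1 M - sylvester d 1 M')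
              < sing_val ((k' + d) * m) (sylvester d k' M) / sqrt (real k') \<longrightarrow>
            full_sylvester_rank d M'))) \<and>
    (\<forall>M \<in> (polymats m (m + n) d :: complex poly mat set). full_sylvester_rank d M \<longrightarrow>
       (k' > 1 \<and> t > 0 \<longrightarrow>
         (\<forall>M' \<in> (polymats m (m + n) d :: complex poly mat set).
            norm2 (sylvester d 1 M - sylvester d 1 M')
              < min (sing_val ((k' - 1) * (m + n)) (sylvester d (k' - 1) M) / sqrt (real (k' - 1)))
                    (sing_val ((k' + d) * m) (sylvester d k' M) / sqrt (real k')) \<longrightarrow>
            full_sylvester_rank d M')) \<and>
       (k' = 1 \<or> t = 0 \<longrightarrow>
         (\<forall>M' \<in> (polymats m (m + n) d :: complex poly mat set).
            norm2 (sylvester d 1 M - sylvester d 1 M')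
              < sing_val ((k' + d) * m) (sylvester d k' M) / sqrt (real k') \<longrightarrow>
            full_sylvester_rank d M')))"
proof -
  have "real (m * d) / real n > 0" using assms by simp
  \<comment> \<open>The quotient is positive, so \<open>nat\<close> loses nothing.\<close>
  then have ceil: "int k' = \<lceil>real (m * d) / real n\<rceil>"
    using assms(4) by simp
  have kpos: "k' > 0" using \<open>real (m * d) / real n > 0\<close> assms(4) by simp
  have "real (m * d) / real n \<le> real k'" "real k' < real (m * d) / real n + 1"
    using ceil by linarith+
  then have "real (m * d) \<le> real (n * k')" "real (n * k') < real (m * d + n)"
    using assms(2) by (simp_all add: field_simps)
  then have wide: "m * d \<le> n * k'" and less: "n * k' < m * d + n"
    by (simp_all only: of_nat_le_iff of_nat_less_iff)
  \<comment> \<open>This is \<open>t < n\<close> rearranged; the truncated subtraction is exact as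
    \<open>k'\<close> is positive.\<close>
  have tall: "n * (k' - 1) < m * d"
    using less kpos by (cases k') auto
  have t: "0 \<le> t" "t < int n" "t = 0 \<longleftrightarrow> n * k' = m * d"
    using wide less assms(5) by (simp_all flip: of_nat_mult of_nat_add)
  show ?thesis
    using t real_rc.full_sylvester_rank_perturbation[OF _ _ assms(1) kpos wide tall]
      complex_rc.full_sylvester_rank_perturbation[OF _ _ assms(1) kpos wide tall]
    by auto
qed

end
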